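(* Let $(\mathfrak B,\beta)$ be a unital $\mathbb Z_2$-graded $C^*$-algebra and let $(\mathfrak A,\theta)$ be its infinite Fermi $C^*$-tensor product over $\mathbb N$, with the natural action $\alpha$ of the group $\mathbb P$ of finite permutations of $\mathbb N$. For each symmetric state $\omega\in\mathcal S_{\mathbb P}(\mathfrak A)$: (i) $\omega$ is even, i.e. $\omega\circ\theta=\omega$; (ii) $\omega$ is $\mathbb P$-abelian, i.e. the operators in $E_\omega\pi_\omega(\mathfrak A)E_\omega$ mutually commute; (iii) $\omega$ is asymptotically abelian in average: $M\{\omega(c[\alpha_{\hat g}(a),b]d)\}=0$ for all $a,b,c,d\in\mathfrak A$, where $[x,y]=xy-yx$.
   Context: Graded algebras. A $\mathbb Z_2$-graded $C^*$-algebra is a pair $(\mathfrak C,\gamma)$ with $\mathfrak C$ a $C^*$-algebra and $\gamma$ a $*$-automorphism with $\gamma^2=\mathrm{id}$. Put $\mathfrak C_\pm=\{a:\gamma(a)=\pm a\}$ (even/odd elements; the elements of $\mathfrak C_+\cup\mathfrak C_-$ are homogeneous). A state $\varphi$ is even if $\varphi\circ\gamma=\varphi$ (equivalently $\varphi$ vanishes on $\mathfrak C_-$); $\mathcal S_+(\mathfrak C)$ is the set of even states. Fermi tensor product. For $\mathbb Z_2$-graded $C^*$-algebras $(\mathfrak C,\gamma),(\mathfrak D,\delta)$, the algebraic Fermi product $\mathfrak C\odot_F\mathfrak D$ is the algebraic tensor product $\mathfrak C\odot\mathfrak D$ with product and involution determined on homogeneous elements by $(c\odot d)(c'\odot d')=\epsilon(d,c')\,cc'\odot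 dd'$ and $(c\odot d)^*=\epsilon(c,d)\,c^*\odot d^*$, where $\epsilon(x,y)=-1$ if $x,y$ are both odd and $1$ otherwise. For even states $\varphi,\psi$, the functional $(\varphi\times\psi)(c\odot d)=\varphi(c)\psi(d)$ is positive on $\mathfrak C\odot_F\mathfrak D$ and its GNS representation $\pi_{\varphi\times\psi}$ is by bounded operators. The Fermi $C^*$-tensor product $\mathfrak C\otimes_F\mathfrak D$ is the completion of $\mathfrak C\odot_F\mathfrak D$ in the $C^*$-norm $\|x\|=\sup\{\|\pi_{\varphi\times\psi}(x)\|:\varphi\in\mathcal S_+(\mathfrak C),\psi\in\mathcal S_+(\mathfrak D)\}$; it is $\mathbb Z_2$-graded by the extension of $\gamma\otimes_F\delta: c\odot d\mapsto\gamma(c)\odot\delta(d)$. Infinite product. With $\mathfrak B^{(1)}=\mathfrak B$ and $\mathfrak B^{(n+1)}=\mathfrak B^{(n)}\otimes_F\mathfrak B$, the infinite Fermi $C^*$-tensor product $(\mathfrak A,\theta)$ is the $C^*$-inductive limit of the $\mathfrak B^{(n)}$ under the grading-preserving embeddings $a\mapsto a\otimes_F 1$, with the induced grading. For $j\in\mathbb N=\{0,1,2,\dots\}$, $\iota_j:\mathfrak B\to\mathfrak A$ is the embedding in the $j$-th factor (identity in all other factors); for $i\ne j$ the elements $\iota_i(a),\iota_j(b)$ with $a,b$ homogeneous commute, except that they anticommute if both are odd. Symmetric states. $\mathbb P$ is the group of permutations of $\mathbb N$ moving only finitely many indices, acting on $\mathfrak A$ by the $*$-automorphisms $\alpha_g$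 determined by $\alpha_g\circ\iota_j=\iota_{g(j)}$. $\mathcal S_{\mathbb P}(\mathfrak A)$ is the set of states with $\omega\circ\alpha_g=\omega$ for all $g\in\mathbb P$ (symmetric states). For such $\omega$, $(\mathcal H_\omega,\pi_\omega,U_\omega,\xi_\omega)$ is the covariant GNS representation, with $U_\omega(g)\pi_\omega(a)\xi_\omega=\pi_\omega(\alpha_g(a))\xi_\omega$, and $E_\omega$ is the orthogonal projection of $\mathcal H_\omega$ onto the $U_\omega(\mathbb P)$-invariant vectors. Mean. $M$ is any mean obtained from a Følner sequence of the (amenable, countable, discrete) group $\mathbb P$: $M\{f(\hat g)\}=\lim_n\frac1{|\Lambda_n|}\sum_{g\in\Lambda_n}f(g)$, where $\Lambda_n\subset\mathbb P$ are finite nonempty sets with $|h\Lambda_n\triangle\Lambda_n|/|\Lambda_n|\to0$ for each $h\in\mathbb P$ (e.g. $\Lambda_n=$ the permutations fixing every $k>n$). The hat marks the dummy variable. *)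

theory Defs
  imports "HOL-Analysis.Analysis" "HOL-Combinatorics.Perm"
begin

section \<open>Complex vector spaces, unital C*-algebras, complex Hilbert spaces\<close>

class complex_vector = real_vector +
  fixes scaleC :: "complex \<Rightarrow> 'a \<Rightarrow> 'a"  (infixr \<open>*\<^sub>C\<close> 75)
  assumes scaleC_add_right: "z *\<^sub>C (x + y) = z *\<^sub>C x + z *\<^sub>C y"
    and scaleC_add_left: "(z + w) *\<^sub>C x = z *\<^sub>C x + w *\<^sub>C x"
    and scaleC_scaleC: "z *\<^sub>C w *\<^sub>C x = (z * w) *\<^sub>C x"
    and scaleR_scaleC: "r *\<^sub>R x = complex_of_real r *\<^sub>C x"

global_interpretation complex_vector: vector_space "scaleC :: complex \<Rightarrow> 'a \<Rightarrow> 'a::complex_vector"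
proof
  show "1 *\<^sub>C x = x" for x :: 'a
    using scaleR_scaleC [of 1 x] by simp
qed (auto simp: scaleC_add_right scaleC_add_left scaleC_scaleC)

instantiation complex :: complex_vector
begin

definition scaleC_complex :: "complex \<Rightarrow> complex \<Rightarrow> complex" where
  "scaleC_complex = (*)"

instance
  by standard (auto simp: scaleC_complex_def algebra_simps scaleR_conv_of_real)

end

text \<open>As \<^class>\<open>real_normed_algebra_1\<close> demands \<open>norm 1 = 1\<close>, the algebra 0 is excluded;
  it has no states.\<close>

class cstar_algebra = complex_vector + real_normed_algebra_1 + banach +
  fixes star :: "'a \<Rightarrow> 'a"
  assumes norm_scaleC: "norm (z *\<^sub>C x) = cmod z * norm x"
    and mult_scaleC_left: "(z *\<^sub>C x) * y = z *\<^sub>C (x * y)"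
    and mult_scaleC_right: "x * (z *\<^sub>C y) = z *\<^sub>C (x * y)"
    and star_star: "star (star x) = x"
    and star_add: "star (x + y) = star x + star y"
    and star_scaleC: "star (z *\<^sub>C x) = cnj z *\<^sub>C star x"
    and star_mult: "star (x * y) = star y * star x"
    and norm_star_mult: "norm (star x * x) = (norm x)\<^sup>2"

text \<open>The inner product is linear in the second argument.\<close>

class complex_hilbert = complex_vector + banach +
  fixes cinner :: "'a \<Rightarrow> 'a \<Rightarrow> complex"
  assumes cinner_commute: "cinner x y = cnj (cinner y x)"
    and cinner_add_right: "cinner x (y + z) = cinner x y + cinner x z"
    and cinner_scaleC_right: "cinner x (w *\<^sub>C y) = w * cinner x y"
    and cinner_norm: "cinner x x = complex_of_real ((norm x)\<^sup>2)"

definition clinear_on :: "'a::complex_vector set \<Rightarrow> ('a \<Rightarrow> 'b::complex_vector) \<Rightarrow> bool" where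
  "clinear_on V f \<longleftrightarrow>
     (\<forall>x\<in>V. \<forall>y\<in>V. f (x + y) = f x + f y) \<and> (\<forall>z. \<forall>x\<in>V. f (z *\<^sub>C x) = z *\<^sub>C f x)"


section \<open>Graded C*-algebras and states\<close>

text \<open>A C*-algebra is given by a carrier \<open>C\<close>, a closed *-subalgebra containing the unit of an
  algebra of class \<^class>\<open>cstar_algebra\<close>; the carrier may be \<^const>\<open>UNIV\<close>. Maps on \<open>C\<close> are maps
  on the type whose values outside \<open>C\<close> are irrelevant.\<close>

definition cstar_subalgebra :: "'a::cstar_algebra set \<Rightarrow> bool" where
  "cstar_subalgebra C \<longleftrightarrow> complex_vector.subspace C \<and> closed C \<and> 1 \<in> C \<and>
     (\<forall>x\<in>C. \<forall>y\<in>C. x * y \<in> C) \<and> (\<forall>x\<in>C. star x \<in> C)"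

definition star_isomorphism :: "'a::cstar_algebra set \<Rightarrow> 'b::cstar_algebra set \<Rightarrow> ('a \<Rightarrow> 'b) \<Rightarrow> bool" where
  "star_isomorphism C D f \<longleftrightarrow> bij_betw f C D \<and> clinear_on C f \<and>
     (\<forall>x\<in>C. \<forall>y\<in>C. f (x * y) = f x * f y) \<and> (\<forall>x\<in>C. f (star x) = star (f x))"

definition graded_cstar_algebra :: "'a::cstar_algebra set \<Rightarrow> ('a \<Rightarrow> 'a) \<Rightarrow> bool" where
  "graded_cstar_algebra C \<gamma> \<longleftrightarrow>
     cstar_subalgebra C \<and> star_isomorphism C C \<gamma> \<and> (\<forall>x\<in>C. \<gamma> (\<gamma> x) = x)"

definition homogeneous :: "'a::cstar_algebra set \<Rightarrow> ('a \<Rightarrow> 'a) \<Rightarrow> 'a set" where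
  "homogeneous C \<gamma> = {x \<in> C. \<gamma> x = x \<or> \<gamma> x = - x}"

definition state_on :: "'a::cstar_algebra set \<Rightarrow> ('a \<Rightarrow> complex) \<Rightarrow> bool" where
  "state_on C \<phi> \<longleftrightarrow> clinear_on C \<phi> \<and> (\<forall>x\<in>C. \<phi> (star x * x) \<in> \<real>\<^sub>\<ge>\<^sub>0) \<and> \<phi> 1 = 1"

definition even_state_on :: "'a::cstar_algebra set \<Rightarrow> ('a \<Rightarrow> 'a) \<Rightarrow> ('a \<Rightarrow> complex) \<Rightarrow> bool" where
  "even_state_on C \<gamma> \<phi> \<longleftrightarrow> state_on C \<phi> \<and> (\<forall>x\<in>C. \<phi> (\<gamma> x) = \<phi> x)"


section \<open>The Fermi C*-tensor product\<close>

text \<open>\<open>X\<close> with the bilinear map \<open>ten\<close> is an algebraic tensor product of the spaces \<open>C\<close> and \<open>D\<close>: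
  it is spanned by the elementary tensors and bilinear maps factor through it. The latter is only
  required for bilinear forms, as a definition cannot quantify over all target spaces; since
  linear functionals separate points, this already makes the induced map from the tensor product
  to \<open>X\<close> injective.\<close>

definition algebraic_tensor_product ::
    "'c::complex_vector set \<Rightarrow> 'd::complex_vector set \<Rightarrow> ('c \<Rightarrow> 'd \<Rightarrow> 't::complex_vector) \<Rightarrow> 't set \<Rightarrow> bool" where
  "algebraic_tensor_product C D ten X \<longleftrightarrow>
     (\<forall>c\<in>C. clinear_on D (\<lambda>d. ten c d)) \<and> (\<forall>d\<in>D. clinear_on C (\<lambda>c. ten c d)) \<and>
     X = complex_vector.span {ten c d | c d. c \<in> C \<and> d \<in> D} \<and>
     (\<forall>f :: 'c \<Rightarrow> 'd \<Rightarrow> complex.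
        (\<forall>c\<in>C. clinear_on D (\<lambda>d. f c d)) \<and> (\<forall>d\<in>D. clinear_on C (\<lambda>c. f c d)) \<longrightarrow>
        (\<exists>F. clinear_on X F \<and> (\<forall>c\<in>C. \<forall>d\<in>D. F (ten c d) = f c d)))"

definition fermi_sign :: "('x::cstar_algebra \<Rightarrow> 'x) \<Rightarrow> ('y::cstar_algebra \<Rightarrow> 'y) \<Rightarrow> 'x \<Rightarrow> 'y \<Rightarrow> complex" where
  "fermi_sign \<gamma> \<delta> x y = (if \<gamma> x = - x \<and> \<delta> y = - y then - 1 else 1)"

text \<open>The product and involution of the algebraic Fermi product are those of the ambient type \<open>'t\<close>.\<close>

definition algebraic_fermi_product ::
    "'c::cstar_algebra set \<Rightarrow> ('c \<Rightarrow> 'c) \<Rightarrow> 'd::cstar_algebra set \<Rightarrow> ('d \<Rightarrow> 'd) \<Rightarrow>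
     ('c \<Rightarrow> 'd \<Rightarrow> 't::cstar_algebra) \<Rightarrow> 't set \<Rightarrow> bool" where
  "algebraic_fermi_product C \<gamma> D \<delta> ten X \<longleftrightarrow>
     algebraic_tensor_product C D ten X \<and>
     (\<forall>c\<in>homogeneous C \<gamma>. \<forall>d\<in>homogeneous D \<delta>. \<forall>c'\<in>homogeneous C \<gamma>. \<forall>d'\<in>homogeneous D \<delta>.
        ten c d * ten c' d' = fermi_sign \<delta> \<gamma> d c' *\<^sub>C ten (c * c') (d * d')) \<and>
     (\<forall>c\<in>homogeneous C \<gamma>. \<forall>d\<in>homogeneous D \<delta>.
        star (ten c d) = fermi_sign \<gamma> \<delta> c d *\<^sub>C ten (star c) (star d))"

text \<open>The product functionals \<open>\<phi> \<times> \<psi>\<close> of even states.\<close>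

definition even_product_functionals ::
    "'c::cstar_algebra set \<Rightarrow> ('c \<Rightarrow> 'c) \<Rightarrow> 'd::cstar_algebra set \<Rightarrow> ('d \<Rightarrow> 'd) \<Rightarrow>
     ('c \<Rightarrow> 'd \<Rightarrow> 't::cstar_algebra) \<Rightarrow> 't set \<Rightarrow> ('t \<Rightarrow> complex) set" where
  "even_product_functionals C \<gamma> D \<delta> ten X =
     {\<rho>. clinear_on X \<rho> \<and> (\<exists>\<phi> \<psi>. even_state_on C \<gamma> \<phi> \<and> even_state_on D \<delta> \<psi> \<and>
           (\<forall>c\<in>C. \<forall>d\<in>D. \<rho> (ten c d) = \<phi> c * \<psi> d))}"

text \<open>For a positive functional \<open>\<rho>\<close> on a unital *-algebra \<open>X\<close>, the GNS space is the completion of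
  \<open>X\<close> modulo the null vectors of the semi-inner product \<open>\<rho> (star x * y)\<close>, with \<open>\<pi>\<^sub>\<rho> x [y] = [x * y]\<close>.
  The operator norm of \<open>\<pi>\<^sub>\<rho> x\<close> is computed on the dense subspace of the vectors \<open>[y]\<close>; as for
  \<^const>\<open>onorm\<close>, the convention \<open>t / 0 = 0\<close> takes care of null vectors.\<close>

definition gns_seminorm :: "('t::cstar_algebra \<Rightarrow> complex) \<Rightarrow> 't \<Rightarrow> real" where
  "gns_seminorm \<rho> y = sqrt (Re (\<rho> (star y * y)))"

definition gns_operator_norm :: "'t::cstar_algebra set \<Rightarrow> ('t \<Rightarrow> complex) \<Rightarrow> 't \<Rightarrow> real" where
  "gns_operator_norm X \<rho> x = (SUP y\<in>X. gns_seminorm \<rho> (x * y) / gns_seminorm \<rho> y)"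

definition fermi_norm ::
    "'c::cstar_algebra set \<Rightarrow> ('c \<Rightarrow> 'c) \<Rightarrow> 'd::cstar_algebra set \<Rightarrow> ('d \<Rightarrow> 'd) \<Rightarrow>
     ('c \<Rightarrow> 'd \<Rightarrow> 't::cstar_algebra) \<Rightarrow> 't set \<Rightarrow> 't \<Rightarrow> real" where
  "fermi_norm C \<gamma> D \<delta> ten X x =
     (SUP \<rho>\<in>even_product_functionals C \<gamma> D \<delta> ten X. gns_operator_norm X \<rho> x)"

text \<open>\<open>(T, \<tau>)\<close> with \<open>ten\<close> is the Fermi C*-tensor product of \<open>(C, \<gamma>)\<close> and \<open>(D, \<delta>)\<close>: it contains the
  algebraic Fermi product as a dense *-subalgebra on which its norm is the Fermi norm.\<close>

definition fermi_cstar_product ::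
    "'c::cstar_algebra set \<Rightarrow> ('c \<Rightarrow> 'c) \<Rightarrow> 'd::cstar_algebra set \<Rightarrow> ('d \<Rightarrow> 'd) \<Rightarrow>
     ('c \<Rightarrow> 'd \<Rightarrow> 't::cstar_algebra) \<Rightarrow> 't set \<Rightarrow> ('t \<Rightarrow> 't) \<Rightarrow> bool" where
  "fermi_cstar_product C \<gamma> D \<delta> ten T \<tau> \<longleftrightarrow>
     graded_cstar_algebra C \<gamma> \<and> graded_cstar_algebra D \<delta> \<and> graded_cstar_algebra T \<tau> \<and>
     (\<exists>X. algebraic_fermi_product C \<gamma> D \<delta> ten X \<and> T = closure X \<and>
          (\<forall>x\<in>X. norm x = fermi_norm C \<gamma> D \<delta> ten X x)) \<and>
     (\<forall>c\<in>C. \<forall>d\<in>D. \<tau> (ten c d) = ten (\<gamma> c) (\<delta> d))"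


section \<open>The infinite Fermi C*-tensor product\<close>

text \<open>The type \<open>'a\<close> with the grading \<open>\<theta>\<close> is the inductive limit of the finite Fermi powers of the
  algebra \<open>'b\<close> with grading \<open>\<beta>\<close>. The embeddings of an inductive system of C*-algebras into its limit
  are isometric, so the powers are taken as subalgebras of \<open>'a\<close>, \<open>S n\<close> being the power with the
  \<open>n + 1\<close> factors \<open>0, \<dots>, n\<close>; the connecting map sending \<open>a\<close> to its tensor product with 1 becomes an
  inclusion. The map \<open>\<iota> j\<close> embeds \<open>'b\<close> as the factor \<open>j\<close>.\<close>

definition infinite_fermi_product ::
    "('b::cstar_algebra \<Rightarrow> 'b) \<Rightarrow> (nat \<Rightarrow> 'b \<Rightarrow> 'a::cstar_algebra) \<Rightarrow> ('a \<Rightarrow> 'a) \<Rightarrow> bool" where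
  "infinite_fermi_product \<beta> \<iota> \<theta> \<longleftrightarrow>
     graded_cstar_algebra UNIV \<theta> \<and>
     (\<exists>(S :: nat \<Rightarrow> 'a set) (ten :: nat \<Rightarrow> 'a \<Rightarrow> 'b \<Rightarrow> 'a).
        star_isomorphism UNIV (S 0) (\<iota> 0) \<and> (\<forall>b. \<theta> (\<iota> 0 b) = \<iota> 0 (\<beta> b)) \<and>
        (\<forall>n. fermi_cstar_product (S n) \<theta> UNIV \<beta> (ten n) (S (Suc n)) \<theta> \<and>
             (\<forall>a\<in>S n. ten n a 1 = a) \<and> (\<forall>b. ten n 1 b = \<iota> (Suc n) b)) \<and>
        closure (\<Union>n. S n) = UNIV)"


section \<open>Symmetric states\<close>

text \<open>The group of finite permutations of the natural numbers is the type \<^typ>\<open>nat perm\<close>. The union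
  of the ranges of the \<open>\<iota> j\<close> generates the infinite product, so \<open>\<iota>\<close> determines each \<open>\<alpha> g\<close>.\<close>

definition permutation_action ::
    "(nat \<Rightarrow> 'b \<Rightarrow> 'a::cstar_algebra) \<Rightarrow> (nat perm \<Rightarrow> 'a \<Rightarrow> 'a) \<Rightarrow> bool" where
  "permutation_action \<iota> \<alpha> \<longleftrightarrow>
     (\<forall>g. star_isomorphism UNIV UNIV (\<alpha> g) \<and> (\<forall>j b. \<alpha> g (\<iota> j b) = \<iota> (Perm.apply g j) b))"

definition symmetric_state :: "(nat perm \<Rightarrow> 'a::cstar_algebra \<Rightarrow> 'a) \<Rightarrow> ('a \<Rightarrow> complex) \<Rightarrow> bool" where
  "symmetric_state \<alpha> \<omega> \<longleftrightarrow> state_on UNIV \<omega> \<and> (\<forall>g. \<omega> \<circ> \<alpha> g = \<omega>)"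

text \<open>The GNS Hilbert space is a closed subspace \<open>H\<close> of a Hilbert space type, because a type
  cannot depend on \<open>\<omega>\<close>.\<close>

definition gns_representation ::
    "('a::cstar_algebra \<Rightarrow> complex) \<Rightarrow> 'h::complex_hilbert set \<Rightarrow> ('a \<Rightarrow> 'h \<Rightarrow> 'h) \<Rightarrow> 'h \<Rightarrow> bool" where
  "gns_representation \<omega> H \<pi> \<xi> \<longleftrightarrow>
     complex_vector.subspace H \<and> closed H \<and> \<xi> \<in> H \<and>
     (\<forall>a. \<pi> a ` H \<subseteq> H \<and> clinear_on H (\<pi> a) \<and> (\<exists>K. \<forall>x\<in>H. norm (\<pi> a x) \<le> K * norm x)) \<and>
     (\<forall>x\<in>H. clinear_on UNIV (\<lambda>a. \<pi> a x)) \<and>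
     (\<forall>a b. \<forall>x\<in>H. \<pi> (a * b) x = \<pi> a (\<pi> b x)) \<and>
     (\<forall>a. \<forall>x\<in>H. \<forall>y\<in>H. cinner (\<pi> (star a) x) y = cinner x (\<pi> a y)) \<and>
     closure (range (\<lambda>a. \<pi> a \<xi>)) = H \<and>
     (\<forall>a. \<omega> a = cinner \<xi> (\<pi> a \<xi>))"

definition unitary_on :: "'h::complex_hilbert set \<Rightarrow> ('h \<Rightarrow> 'h) \<Rightarrow> bool" where
  "unitary_on H u \<longleftrightarrow> clinear_on H u \<and> u ` H = H \<and> (\<forall>x\<in>H. \<forall>y\<in>H. cinner (u x) (u y) = cinner x y)"

definition covariant_gns_representation ::
    "(nat perm \<Rightarrow> 'a::cstar_algebra \<Rightarrow> 'a) \<Rightarrow> ('a \<Rightarrow> complex) \<Rightarrow>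
     'h::complex_hilbert set \<Rightarrow> ('a \<Rightarrow> 'h \<Rightarrow> 'h) \<Rightarrow> (nat perm \<Rightarrow> 'h \<Rightarrow> 'h) \<Rightarrow> 'h \<Rightarrow> bool" where
  "covariant_gns_representation \<alpha> \<omega> H \<pi> U \<xi> \<longleftrightarrow>
     gns_representation \<omega> H \<pi> \<xi> \<and>
     (\<forall>g. unitary_on H (U g) \<and> (\<forall>a. U g (\<pi> a \<xi>) = \<pi> (\<alpha> g a) \<xi>))"

definition orthogonal_projection :: "'h::complex_hilbert set \<Rightarrow> 'h \<Rightarrow> 'h" where
  "orthogonal_projection K x = (THE y. y \<in> K \<and> (\<forall>z\<in>K. cinner z (x - y) = 0))"

definition invariant_projection ::
    "'h::complex_hilbert set \<Rightarrow> (nat perm \<Rightarrow> 'h \<Rightarrow> 'h) \<Rightarrow> 'h \<Rightarrow> 'h" where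
  "invariant_projection H U = orthogonal_projection {x \<in> H. \<forall>g. U g x = x}"

definition P_abelian ::
    "'h::complex_hilbert set \<Rightarrow> ('a \<Rightarrow> 'h \<Rightarrow> 'h) \<Rightarrow> (nat perm \<Rightarrow> 'h \<Rightarrow> 'h) \<Rightarrow> bool" where
  "P_abelian H \<pi> U \<longleftrightarrow>
     (let E = invariant_projection H U; R = range (\<lambda>a. E \<circ> \<pi> a \<circ> E)
      in \<forall>s\<in>R. \<forall>t\<in>R. \<forall>x\<in>H. s (t x) = t (s x))"


section \<open>Means over the finite permutations\<close>

definition folner_sequence :: "(nat \<Rightarrow> nat perm set) \<Rightarrow> bool" where
  "folner_sequence \<Lambda> \<longleftrightarrow> (\<forall>n. finite (\<Lambda> n) \<and> \<Lambda> n \<noteq> {}) \<and>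
     (\<forall>h. (\<lambda>n. real (card (sym_diff ((\<lambda>g. h * g) ` \<Lambda> n) (\<Lambda> n))) / real (card (\<Lambda> n))) \<longlonglongrightarrow> 0)"

definition has_mean :: "(nat \<Rightarrow> nat perm set) \<Rightarrow> (nat perm \<Rightarrow> complex) \<Rightarrow> complex \<Rightarrow> bool" where
  "has_mean \<Lambda> f m \<longleftrightarrow> (\<lambda>n. (\<Sum>g\<in>\<Lambda> n. f g) / of_nat (card (\<Lambda> n))) \<longlonglongrightarrow> m"

definition asymptotically_abelian_in_average ::
    "(nat perm \<Rightarrow> 'a::cstar_algebra \<Rightarrow> 'a) \<Rightarrow> ('a \<Rightarrow> complex) \<Rightarrow> bool" where
  "asymptotically_abelian_in_average \<alpha> \<omega> \<longleftrightarrow>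
     (\<forall>\<Lambda>. folner_sequence \<Lambda> \<longrightarrow>
        (\<forall>a b c d. has_mean \<Lambda> (\<lambda>g. \<omega> (c * (\<alpha> g a * b - b * \<alpha> g a) * d)) 0))"

end

theory Submission
  imports Defs
begin

text \<open>Everything is checked on monomials \<open>\<iota> j\<^sub>1 b\<^sub>1 * \<dots> * \<iota> j\<^sub>n b\<^sub>n\<close> with homogeneous \<open>b\<^sub>i\<close>: they span a
dense subspace (\<open>monomials_dense\<close>), they have a parity and a finite set of sites, and monomials on
disjoint sets of sites commute up to the sign given by their parities (\<open>monomial_commute\<close>).

The heart of the matter is that a symmetric state cannot see an odd monomial \<open>a\<close> located away from
everything else: \<open>\<omega> (c * a * y) = 0\<close> if the sites of \<open>a\<close> are disjoint from those of the monomials \<open>c\<close>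
and \<open>y\<close> (\<open>odd_monomial_vanishes\<close>). Indeed, by symmetry \<open>a\<close> may be replaced by any of \<open>N\<close> copies
\<open>x\<^sub>1, \<dots>, x\<^sub>N\<close> of \<open>a\<close> on pairwise disjoint sites. Copies on different sites are odd and so anticommute,
also after taking adjoints, and the sum \<open>X\<close> of all copies satisfies
\<open>star X * X + X * star X = (\<Sum>i. star x\<^sub>i * x\<^sub>i + x\<^sub>i * star x\<^sub>i)\<close>. The right-hand side grows only linearly
in \<open>N\<close>, and the Cauchy-Schwarz inequality bounds \<open>N * \<omega> (c * a * y) = \<omega> (c * X * y)\<close> by a multiple of the
square root of \<open>N\<close>.

Evenness of \<open>\<omega>\<close> is the case \<open>c = y = 1\<close>. For asymptotic abelianness, let \<open>a, b, c, d\<close> be monomials.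
As soon as \<open>g\<close> moves the sites of \<open>a\<close> away from those of \<open>b, c, d\<close>, the number
\<open>\<omega> (c * (\<alpha> g a * b - b * \<alpha> g a) * d)\<close> is zero: the commutator vanishes if \<open>a\<close> is even, and the state
annihilates both of its terms if \<open>a\<close> is odd. The exceptional \<open>g\<close> have density zero along every
Folner sequence (\<open>folner_site_negligible\<close>). The bound
\<open>cmod (\<omega> (c * \<alpha> g x * y)) \<le> norm c * norm x * norm y\<close>, uniform in \<open>g\<close>, carries the result from
monomials to all elements of the algebra.

For the compressed operators to commute, average over the symmetric groups on \<open>n\<close> letters: these averages
are a decreasing sequence of projections that converges strongly to the projection \<open>E\<close> onto the invariant
vectors (\<open>mean_ergodic\<close>). For invariant vectors \<open>x\<close> and \<open>y\<close>, the means of the matrix coefficients of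
\<open>\<pi> (\<alpha> g a) \<pi> b\<close> and of \<open>\<pi> b \<pi> (\<alpha> g a)\<close> between \<open>x\<close> and \<open>y\<close> are therefore the coefficients of
\<open>\<pi> a E \<pi> b\<close> and of \<open>\<pi> b E \<pi> a\<close>, and asymptotic abelianness says that they agree.\<close>

section \<open>Positive functionals on C*-algebras\<close>

text \<open>One inequality for both the inner product of a Hilbert space and the form \<open>\<phi> (star x * y)\<close> of a
positive functional \<open>\<phi>\<close>. Positivity already makes the form Hermitian, by polarization.\<close>

lemma cauchy_schwarz_sesquilinear:
  fixes s :: "'x::complex_vector \<Rightarrow> 'x \<Rightarrow> complex"
  assumes addr: "\<And>x y z. s x (y + z) = s x y + s x z"
    and scaler: "\<And>w x y. s x (w *\<^sub>C y) = w * s x y"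
    and addl: "\<And>x y z. s (x + y) z = s x z + s y z"
    and scalel: "\<And>w x y. s (w *\<^sub>C x) y = cnj w * s x y"
    and pos: "\<And>x. s x x \<in> \<real>\<^sub>\<ge>\<^sub>0"
  shows "(cmod (s x y))\<^sup>2 \<le> Re (s x x) * Re (s y y)"
proof -
  have re: "Im (s x x) = 0" "Re (s x x) \<ge> 0" for x
    using pos[of x] by (auto simp: complex_nonneg_Reals_iff)
  have herm: "s y x = cnj (s x y)" for x y
  proof -
    have "Im (s (x + y) (x + y)) = 0" "Im (s (x + \<i> *\<^sub>C y) (x + \<i> *\<^sub>C y)) = 0"
      by (rule re)+
    then have "Im (s x y) + Im (s y x) = 0" "Re (s x y) - Re (s y x) = 0"
      by (auto simp: addr addl scaler scalel re)
    then show ?thesis by (simp add: complex_eq_iff)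
  qed
  define t where "t = s x y"
  define a where "a = Re (s x x)"
  define b where "b = Re (s y y)"
  have a: "s x x = of_real a" and b: "s y y = of_real b"
    using re by (simp_all add: a_def b_def complex_eq_iff)
  \<comment> \<open>Positivity of the form at the vector \<open>- (r * t) *\<^sub>C x + y\<close>, as a quadratic polynomial in the real number \<open>r\<close>.\<close>
  have quad: "r\<^sup>2 * (cmod t)\<^sup>2 * a - 2 * r * (cmod t)\<^sup>2 + b \<ge> 0" for r
  proof -
    define z where "z = - (of_real r * t)"
    have "s (z *\<^sub>C x + y) (z *\<^sub>C x + y) =
        cnj z * z * s x x + cnj z * s x y + z * cnj (s x y) + s y y"
      by (simp add: addr addl scaler scalel herm[of y x] algebra_simps)
    also have "\<dots> = of_real (r\<^sup>2 * (cmod t)\<^sup>2 * a - 2 * r * (cmod t)\<^sup>2 + b)"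
    proof -
      have "cnj t * t = of_real ((cmod t)\<^sup>2)"
        by (metis complex_norm_square mult.commute of_real_power)
      note tt = this
      have "cnj z * z * s x x + cnj z * s x y + z * cnj (s x y) + s y y =
          of_real (r * r) * (cnj t * t) * of_real a - 2 * of_real r * (cnj t * t) + of_real b"
        unfolding z_def a b t_def[symmetric] by (simp add: algebra_simps)
      then show ?thesis unfolding tt by (simp add: power2_eq_square)
    qed
    finally show ?thesis using re(2)[of "z *\<^sub>C x + y"] by simp
  qed
  have "(cmod t)\<^sup>2 \<le> a * b"
  proof (cases "t = 0")
    case True
    then show ?thesis using re by (simp add: a_def b_def)
  next
    case False
    \<comment> \<open>If \<open>a = 0\<close> then the polynomial is affine with negative slope; at the chosen \<open>r\<close> its value is \<open>- 1\<close>.\<close>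
    have "a \<noteq> 0"
    proof
      assume "a = 0"
      then have "(2 * b + 2) / 2 \<le> b"
        using quad[of "(b + 1) / (2 * (cmod t)\<^sup>2)"] False by simp
      then show False by simp
    qed
    then have "a > 0" using re(2)[of x] by (simp add: a_def)
    have "(1/a)\<^sup>2 * (cmod t)\<^sup>2 * a - 2 * (1/a) * (cmod t)\<^sup>2 + b = b - (cmod t)\<^sup>2 / a"
      using \<open>a > 0\<close> by (simp add: field_simps power2_eq_square)
    then have "b - (cmod t)\<^sup>2 / a \<ge> 0" using quad[of "1/a"] by simp
    then show ?thesis using \<open>a > 0\<close> by (simp add: field_simps)
  qed
  then show ?thesis by (simp add: a_def b_def t_def)
qed

lemma star_one [simp]: "star 1 = (1::'a::cstar_algebra)"
  by (metis mult.left_neutral mult.right_neutral star_mult star_star)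

lemma norm_star [simp]: "norm (star x) = norm (x::'a::cstar_algebra)"
proof -
  have le: "norm x \<le> norm (star x)" for x :: 'a
  proof (cases "x = 0")
    case False
    have "norm x * norm x \<le> norm (star x) * norm x"
      using norm_mult_ineq[of "star x" x] norm_star_mult[of x] by (simp add: power2_eq_square)
    then show ?thesis using False by simp
  qed simp
  show ?thesis using le[of x] le[of "star x"] by (simp add: star_star)
qed

lemma star_scaleR: "star (r *\<^sub>R x) = r *\<^sub>R star (x::'a::cstar_algebra)"
  by (simp add: scaleR_scaleC star_scaleC)

lemma star_minus: "star (- x) = - star (x::'a::cstar_algebra)"
  using star_scaleR[of "-1" x] by simp

lemma bounded_linear_star: "bounded_linear (star :: 'a::cstar_algebra \<Rightarrow> 'a)"
  by (rule bounded_linear_intro[where K=1]) (simp_all add: star_add star_scaleR)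

text \<open>The root is sought as \<open>1 - y\<close>: the equation \<open>(1 - y) * (1 - y) = 1 - h\<close> says that \<open>y\<close> is a fixed point
of \<open>y \<mapsto> (h + y * y) / 2\<close>, and this map contracts the self-adjoint part of the ball of radius
\<open>norm h < 1\<close>. The Banach fixed point theorem thus replaces functional calculus.\<close>

lemma exists_selfadjoint_sqrt_one_minus:
  fixes h :: "'a::cstar_algebra"
  assumes h: "star h = h" and n: "norm h < 1"
  shows "\<exists>k. star k = k \<and> k * k = 1 - h"
proof -
  define r where "r = norm h"
  define B where "B = cball (0::'a) r \<inter> {y. star y = y}"
  define f where "f y = (1/2) *\<^sub>R (h + y * y)" for y
  have r: "0 \<le> r" "r < 1" using n by (auto simp: r_def)
  have "closed {y::'a. star y = y}"
    by (rule closed_Collect_eq) (auto intro: linear_continuous_on bounded_linear_star continuous_intros)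
  then have "complete B" unfolding B_def by (auto simp: complete_eq_closed)
  have "0 \<in> B" using r linear_0[OF bounded_linear.linear, OF bounded_linear_star] by (simp add: B_def)
  then have "B \<noteq> {}" by blast
  moreover note \<open>complete B\<close>
  moreover have "f ` B \<subseteq> B"
  proof
    fix z assume "z \<in> f ` B"
    then obtain y where y: "norm y \<le> r" "star y = y" and z: "z = f y" by (auto simp: B_def)
    have "norm (y * y) \<le> r * r"
      by (meson mult_mono' norm_ge_zero norm_mult_ineq order_trans y(1))
    also have "\<dots> \<le> r" using r by (simp add: mult_left_le)
    finally have "norm (h + y * y) \<le> 2 * r" using norm_triangle_ineq[of h "y*y"] by (simp add: r_def)
    then show "z \<in> B" using y h by (simp add: B_def z f_def star_scaleR star_add star_mult)
  qed
  moreover have "dist (f x) (f y) \<le> r * dist x y" if "x \<in> B" "y \<in> B" for x y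
  proof -
    have "f x - f y = (1/2) *\<^sub>R (x * (x - y) + (x - y) * y)"
      by (simp add: f_def algebra_simps flip: scaleR_diff_right)
    also have "norm \<dots> \<le> (1/2) * (norm x * norm (x - y) + norm (x - y) * norm y)"
      by (simp, meson add_mono norm_mult_ineq norm_triangle_le)
    also have "\<dots> \<le> (1/2) * (r * norm (x - y) + norm (x - y) * r)"
      using that by (intro mult_left_mono add_mono mult_right_mono) (auto simp: B_def)
    finally show ?thesis by (simp add: dist_norm)
  qed
  ultimately obtain y where y: "y \<in> B" "f y = y"
    using Banach_fix[of B r f] r by (metis)
  have "h + y * y = 2 *\<^sub>R y"
    using y(2) by (metis f_def scaleR_scaleR scaleR_one mult_2 one_add_one divide_self_if mult.right_neutral times_divide_eq_right zero_neq_numeral)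
  then have "(1 - y) * (1 - y) = 1 - h"
    by (simp add: algebra_simps scaleR_2)
  moreover have "star (1 - y) = 1 - y"
    using y(1) by (simp add: B_def linear_diff[OF bounded_linear.linear, OF bounded_linear_star])
  ultimately show ?thesis by blast
qed

locale positive_functional =
  fixes \<phi> :: "'a::cstar_algebra \<Rightarrow> complex"
  assumes linear: "clinear_on UNIV \<phi>" and positive: "\<And>x. \<phi> (star x * x) \<in> \<real>\<^sub>\<ge>\<^sub>0"
begin

lemma add: "\<phi> (x + y) = \<phi> x + \<phi> y" and scale: "\<phi> (z *\<^sub>C x) = z * \<phi> x"
  using linear by (auto simp: clinear_on_def scaleC_complex_def)

lemma scaleR: "\<phi> (r *\<^sub>R x) = of_real r * \<phi> x"
  by (simp add: scaleR_scaleC scale)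

lemma zero [simp]: "\<phi> 0 = 0"
  using scaleR[of 0 0] by simp

lemma minus: "\<phi> (- x) = - \<phi> x"
  using scaleR[of "-1" x] by simp

lemma diff: "\<phi> (x - y) = \<phi> x - \<phi> y"
  using add[of x "- y"] by (simp add: minus)

lemma sum: "\<phi> (sum f A) = (\<Sum>i\<in>A. \<phi> (f i))"
  by (induction A rule: infinite_finite_induct) (auto simp: add)

lemma nonneg: "0 \<le> Re (\<phi> (star x * x))"
  using positive[of x] by (auto simp: complex_nonneg_Reals_iff)

lemma cauchy_schwarz: "(cmod (\<phi> (star x * y)))\<^sup>2 \<le> Re (\<phi> (star x * x)) * Re (\<phi> (star y * y))"
  by (rule cauchy_schwarz_sesquilinear[where s="\<lambda>x y. \<phi> (star x * y)"])
     (auto simp: algebra_simps add scale star_add star_scaleC mult_scaleC_left mult_scaleC_right positive)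

text \<open>For \<open>t > norm (star x * x)\<close> the element \<open>1 - (star x * x) / t\<close> is the square of a self-adjoint element, and
so \<open>\<phi>\<close> is nonnegative on it. Positive functionals are continuous because of this bound.\<close>

lemma square_bound: "Re (\<phi> (star x * x)) \<le> Re (\<phi> 1) * (norm x)\<^sup>2"
proof -
  define h where "h = star x * x"
  have nh: "norm h = (norm x)\<^sup>2" by (simp add: h_def norm_star_mult)
  have le: "Re (\<phi> h) \<le> Re (\<phi> 1) * t" if "t > norm h" for t
  proof -
    have t: "t > 0" using that norm_ge_zero[of h] by linarith
    have "star ((1/t) *\<^sub>R h) = (1/t) *\<^sub>R h" "norm ((1/t) *\<^sub>R h) < 1"
      using t that by (auto simp: star_scaleR h_def star_mult star_star)
    from exists_selfadjoint_sqrt_one_minus[OF this] obtain k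
      where "star k = k" "k * k = 1 - (1/t) *\<^sub>R h" by blast
    then have "0 \<le> Re (\<phi> (1 - (1/t) *\<^sub>R h))" using nonneg[of k] by simp
    then show ?thesis using t by (simp add: diff scaleR field_simps)
  qed
  have "((\<lambda>t. Re (\<phi> 1) * t) \<longlongrightarrow> Re (\<phi> 1) * norm h) (at_right (norm h))"
    by (intro tendsto_intros)
  then have "Re (\<phi> h) \<le> Re (\<phi> 1) * norm h"
    by (rule tendsto_lowerbound) (auto intro: eventually_mono[OF eventually_at_right_less] le)
  then show ?thesis by (simp add: nh h_def[symmetric])
qed

lemma bound: "cmod (\<phi> x) \<le> Re (\<phi> 1) * norm x"
proof -
  have p: "0 \<le> Re (\<phi> 1)" using nonneg[of 1] by simp
  have "(cmod (\<phi> x))\<^sup>2 \<le> Re (\<phi> 1) * Re (\<phi> (star x * x))"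
    using cauchy_schwarz[of 1 x] by simp
  also have "\<dots> \<le> Re (\<phi> 1) * (Re (\<phi> 1) * (norm x)\<^sup>2)"
    by (rule mult_left_mono[OF square_bound p])
  also have "\<dots> = (Re (\<phi> 1) * norm x)\<^sup>2" by (simp add: power2_eq_square)
  finally show ?thesis by (rule power2_le_imp_le) (simp add: p)
qed

end

section \<open>Monomials in the infinite Fermi product\<close>

text \<open>Odd elements have parity \<^const>\<open>True\<close>. The element 0 has both parities.\<close>

definition has_parity :: "('b \<Rightarrow> 'b::ab_group_add) \<Rightarrow> bool \<Rightarrow> 'b \<Rightarrow> bool" where
  "has_parity \<gamma> p x \<longleftrightarrow> \<gamma> x = (if p then - x else x)"

definition koszul_sign :: "bool \<Rightarrow> bool \<Rightarrow> 'a::ring_1" where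
  "koszul_sign p q = (if p \<and> q then - 1 else 1)"

lemma koszul_sign_simps [simp]:
  "koszul_sign False q = 1" "koszul_sign p False = 1" "koszul_sign True True = - 1"
  by (simp_all add: koszul_sign_def)

text \<open>Products of homogeneous elements of single factors, located at sites in \<open>I\<close> and of total parity \<open>p\<close>. A site
may occur several times and in any position, which makes the monomials over \<open>I\<close> closed under products and
adjoints.\<close>

inductive fermi_monomial ::
    "('b::cstar_algebra \<Rightarrow> 'b) \<Rightarrow> (nat \<Rightarrow> 'b \<Rightarrow> 'a::cstar_algebra) \<Rightarrow> nat set \<Rightarrow> bool \<Rightarrow> 'a \<Rightarrow> bool"
  for \<beta> :: "'b \<Rightarrow> 'b" and \<iota> :: "nat \<Rightarrow> 'b \<Rightarrow> 'a" and I :: "nat set" where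
  one: "fermi_monomial \<beta> \<iota> I False 1"
| factor: "\<lbrakk>j \<in> I; has_parity \<beta> p b; fermi_monomial \<beta> \<iota> I q x\<rbrakk>
    \<Longrightarrow> fermi_monomial \<beta> \<iota> I (p \<noteq> q) (\<iota> j b * x)"

lemma fermi_monomial_mono:
  "\<lbrakk>fermi_monomial \<beta> \<iota> I p x; I \<subseteq> J\<rbrakk> \<Longrightarrow> fermi_monomial \<beta> \<iota> J p x"
  by (induction rule: fermi_monomial.induct) (blast intro: fermi_monomial.intros)+

lemma fermi_monomial_mult:
  "\<lbrakk>fermi_monomial \<beta> \<iota> I p x; fermi_monomial \<beta> \<iota> I q y\<rbrakk> \<Longrightarrow> fermi_monomial \<beta> \<iota> I (p \<noteq> q) (x * y)"
proof (induction rule: fermi_monomial.induct)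
  case (factor j p b r x)
  then have "fermi_monomial \<beta> \<iota> I (p \<noteq> (r \<noteq> q)) (\<iota> j b * (x * y))"
    by (blast intro: fermi_monomial.factor)
  moreover have "(p \<noteq> (r \<noteq> q)) = ((p \<noteq> r) \<noteq> q)" by auto
  ultimately show ?case by (simp add: mult.assoc)
qed simp

lemma fermi_monomial_finite_sites:
  assumes "fermi_monomial \<beta> \<iota> UNIV p x"
  shows "\<exists>I. finite I \<and> fermi_monomial \<beta> \<iota> I p x"
  using assms
proof (induction rule: fermi_monomial.induct)
  case one
  show ?case by (blast intro: fermi_monomial.one)
next
  case (factor j p b q x)
  then obtain I where I: "finite I" "fermi_monomial \<beta> \<iota> I q x" by blast
  have "fermi_monomial \<beta> \<iota> (insert j I) (p \<noteq> q) (\<iota> j b * x)"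
    by (rule fermi_monomial.factor) (use factor(2) fermi_monomial_mono[OF I(2)] in auto)
  then show ?case using I(1) by blast
qed

lemma star_isomorphismD:
  assumes "star_isomorphism UNIV UNIV f"
  shows "f (x + y) = f x + f y" "f (z *\<^sub>C x) = z *\<^sub>C f x" "f (x * y) = f x * f y"
    "f (star x) = star (f x)" "f 1 = 1" "f (- x) = - f x" "f (x - y) = f x - f y"
proof -
  show add: "f (x + y) = f x + f y" and sc: "f (z *\<^sub>C x) = z *\<^sub>C f x"
    and mult: "f (x * y) = f x * f y" and "f (star x) = star (f x)" for x y z
    using assms by (auto simp: star_isomorphism_def clinear_on_def)
  obtain u where "f u = 1"
    using assms by (metis UNIV_I bij_betw_def image_iff star_isomorphism_def)
  then show "f 1 = 1" using mult[of u 1] by simp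
  have minus: "f (- x) = - f x" for x
    using sc[of "-1" x] by simp
  then show "f (- x) = - f x" .
  show "f (x - y) = f x - f y" using add[of x "- y"] by (simp add: minus)
qed

definition even_part :: "('c \<Rightarrow> 'c) \<Rightarrow> 'c \<Rightarrow> 'c::complex_vector" where
  "even_part \<gamma> x = (1/2) *\<^sub>C (x + \<gamma> x)"

definition odd_part :: "('c \<Rightarrow> 'c) \<Rightarrow> 'c \<Rightarrow> 'c::complex_vector" where
  "odd_part \<gamma> x = (1/2) *\<^sub>C (x - \<gamma> x)"

lemma parity_decomposition:
  assumes "star_isomorphism UNIV UNIV \<gamma>" and inv: "\<And>x. \<gamma> (\<gamma> x) = x"
  shows "has_parity \<gamma> False (even_part \<gamma> x)" "has_parity \<gamma> True (odd_part \<gamma> x)"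
    "even_part \<gamma> x + odd_part \<gamma> x = x"
proof -
  note f = star_isomorphismD[OF assms(1)]
  show "has_parity \<gamma> False (even_part \<gamma> x)" "has_parity \<gamma> True (odd_part \<gamma> x)"
    by (simp_all add: even_part_def odd_part_def has_parity_def f inv add.commute
        flip: complex_vector.scale_minus_right)
  have "(1/2) *\<^sub>C x + (1/2) *\<^sub>C x = x"
    by (simp flip: scaleC_add_left)
  then show "even_part \<gamma> x + odd_part \<gamma> x = x"
    by (simp add: even_part_def odd_part_def scaleC_add_right complex_vector.scale_right_diff_distrib)
qed

locale fermi_product =
  fixes \<beta> :: "'b::cstar_algebra \<Rightarrow> 'b"
    and \<iota> :: "nat \<Rightarrow> 'b \<Rightarrow> 'a::cstar_algebra"
    and \<theta> :: "'a \<Rightarrow> 'a"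
  assumes graded: "graded_cstar_algebra UNIV \<beta>"
    and product: "infinite_fermi_product \<beta> \<iota> \<theta>"
begin

lemma \<beta>_iso: "star_isomorphism UNIV UNIV \<beta>" and \<beta>_\<beta>: "\<beta> (\<beta> b) = b"
  using graded by (auto simp: graded_cstar_algebra_def)

lemma \<theta>_iso: "star_isomorphism UNIV UNIV \<theta>" and \<theta>_\<theta>: "\<theta> (\<theta> b) = b"
  using product by (auto simp: infinite_fermi_product_def graded_cstar_algebra_def)

lemmas \<beta>_simps = star_isomorphismD[OF \<beta>_iso]
lemmas \<theta>_simps = star_isomorphismD[OF \<theta>_iso]

lemma fermi_sign_one [simp]: "fermi_sign \<gamma> \<delta> (1::'c::cstar_algebra) y = 1" if "\<gamma> 1 = 1"
proof -
  have "(1::'c) \<noteq> - 1"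
    by (metis add.right_inverse one_neq_zero add_self_div_2 norm_one scaleR_2 scaleR_eq_0_iff zero_neq_numeral)
  then show ?thesis using that by (simp add: fermi_sign_def)
qed

text \<open>What the later proofs need to know about the finite Fermi powers. The product rule for homogeneous
elementary tensors identifies \<open>ten n c d\<close> with the product of \<open>c\<close> and \<open>\<iota> (Suc n) d\<close> and yields the graded
commutation of the new factor with the previous ones. An element that is both even and odd is 0, and
therefore any choice of parities gives the correct sign in that rule.\<close>

lemma tower:
  obtains S ten where
    "star_isomorphism UNIV (S 0) (\<iota> 0)"
    "\<And>b. \<theta> (\<iota> 0 b) = \<iota> 0 (\<beta> b)"
    "\<And>n. clinear_on UNIV (ten n 1)"
    "\<And>n c d. c \<in> S n \<Longrightarrow> \<theta> (ten n c d) = ten n (\<theta> c) (\<beta> d)"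
    "\<And>n d. ten n 1 d = \<iota> (Suc n) d"
    "\<And>n c p d q. c \<in> S n \<Longrightarrow> has_parity \<theta> p c \<Longrightarrow> has_parity \<beta> q d \<Longrightarrow>
        ten n c d = c * \<iota> (Suc n) d \<and> \<iota> (Suc n) d * c = koszul_sign p q * ten n c d"
    "\<And>n d q. has_parity \<beta> q d \<Longrightarrow> star (\<iota> (Suc n) d) = \<iota> (Suc n) (star d)"
    "\<And>n c. c \<in> S n \<Longrightarrow> clinear_on UNIV (ten n c)"
    "\<And>n d. clinear_on (S n) (\<lambda>c. ten n c d)"
    "\<And>n. S (Suc n) = closure (complex_vector.span {ten n c d | c d. c \<in> S n})"
    "\<And>n. complex_vector.subspace (S n)"
    "\<And>n c. c \<in> S n \<Longrightarrow> \<theta> c \<in> S n"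
    "\<And>n. 1 \<in> S n"
    "\<And>n. S n \<subseteq> S (Suc n)" "\<And>n d. \<iota> (Suc n) d \<in> S (Suc n)"
    "closure (\<Union>n. S n) = UNIV"
proof -
  obtain S ten where iso0: "star_isomorphism UNIV (S 0) (\<iota> 0)"
    and \<theta>0: "\<And>b. \<theta> (\<iota> 0 b) = \<iota> 0 (\<beta> b)"
    and step: "\<And>n. fermi_cstar_product (S n) \<theta> UNIV \<beta> (ten n) (S (Suc n)) \<theta>"
    and ten_1: "\<And>n a. a \<in> S n \<Longrightarrow> ten n a 1 = a" and one_ten: "\<And>n b. ten n 1 b = \<iota> (Suc n) b"
    and dense: "closure (\<Union>n. S n) = UNIV"
    using product unfolding infinite_fermi_product_def by blast
  have grS: "graded_cstar_algebra (S n) \<theta>" for n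
    using step[of n] by (auto simp: fermi_cstar_product_def)
  then have sub: "complex_vector.subspace (S n)" and one: "1 \<in> S n" for n
    by (auto simp: graded_cstar_algebra_def cstar_subalgebra_def)
  have \<theta>S: "\<theta> c \<in> S n" if "c \<in> S n" for c n
    using grS[of n] that unfolding graded_cstar_algebra_def star_isomorphism_def bij_betw_def by blast
  have alg: "\<exists>X. algebraic_fermi_product (S n) \<theta> UNIV \<beta> (ten n) X \<and> S (Suc n) = closure X" for n
    using step[of n] by (auto simp: fermi_cstar_product_def)
  have \<theta>ten: "\<theta> (ten n c d) = ten n (\<theta> c) (\<beta> d)" if "c \<in> S n" for n c d
    using step[of n] that by (auto simp: fermi_cstar_product_def)
  have lin1: "clinear_on UNIV (ten n c)" if "c \<in> S n" for n c
    using alg[of n] that by (auto simp: algebraic_fermi_product_def algebraic_tensor_product_def)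
  have lin2: "clinear_on (S n) (\<lambda>c. ten n c d)" for n d
    using alg[of n] by (auto simp: algebraic_fermi_product_def algebraic_tensor_product_def)
  have mult: "ten n c d * ten n c' d' = fermi_sign \<beta> \<theta> d c' *\<^sub>C ten n (c * c') (d * d')"
    if "c \<in> homogeneous (S n) \<theta>" "d \<in> homogeneous UNIV \<beta>" "c' \<in> homogeneous (S n) \<theta>"
      "d' \<in> homogeneous UNIV \<beta>" for n c d c' d'
    using alg[of n] that by (auto simp: algebraic_fermi_product_def)
  have starten: "star (ten n c d) = fermi_sign \<theta> \<beta> c d *\<^sub>C ten n (star c) (star d)"
    if "c \<in> homogeneous (S n) \<theta>" "d \<in> homogeneous UNIV \<beta>" for n c d
    using alg[of n] that by (auto simp: algebraic_fermi_product_def)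
  have cl: "S (Suc n) = closure (complex_vector.span {ten n c d | c d. c \<in> S n})" for n
    using alg[of n] by (auto simp: algebraic_fermi_product_def algebraic_tensor_product_def)
  have tenS: "ten n c d \<in> S (Suc n)" if "c \<in> S n" for n c d
    unfolding cl by (rule subsetD[OF closure_subset]) (use that in \<open>auto intro!: complex_vector.span_base\<close>)
  have hom1: "1 \<in> homogeneous (S n) \<theta>" "1 \<in> homogeneous UNIV \<beta>" for n
    using one by (auto simp: homogeneous_def \<theta>_simps \<beta>_simps)
  have par: "d \<in> homogeneous UNIV \<beta>" if "has_parity \<beta> q d" for d q
    using that by (auto simp: homogeneous_def has_parity_def split: if_splits)
  show thesis
  proof (rule that[of S ten])
    show "ten n c d = c * \<iota> (Suc n) d \<and> \<iota> (Suc n) d * c = koszul_sign p q * ten n c d"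
      if c: "c \<in> S n" "has_parity \<theta> p c" and d: "has_parity \<beta> q d" for n c p d q
    proof
      have hc: "c \<in> homogeneous (S n) \<theta>"
        using c by (auto simp: homogeneous_def has_parity_def split: if_splits)
      show "ten n c d = c * \<iota> (Suc n) d"
        using mult[OF hc hom1(2) hom1(1) par[OF d]] c by (simp add: ten_1 one_ten \<beta>_simps)
      have *: "\<iota> (Suc n) d * c = fermi_sign \<beta> \<theta> d c *\<^sub>C ten n c d"
        using mult[OF hom1(1) par[OF d] hc hom1(2)] c by (simp add: ten_1 one_ten)
      have z: "x = 0" if "x = - x" for x :: "'z::real_vector"
        using that by (metis add.right_inverse scaleR_2 scaleR_eq_0_iff zero_neq_numeral)
      have l0: "ten n c 0 = 0" "ten n 0 d = 0"
        using lin1[OF c(1)] lin2[of n d] complex_vector.subspace_0[OF sub[of n]] unfolding clinear_on_def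
        by (metis UNIV_I complex_vector.scale_zero_left)+
      show "\<iota> (Suc n) d * c = koszul_sign p q * ten n c d"
      proof (cases "ten n c d = 0")
        case False
        then have "c \<noteq> 0" "d \<noteq> 0" using l0 by auto
        then have "fermi_sign \<beta> \<theta> d c = (if p \<and> q then - 1 else 1)"
          using c(2) d z[of c] z[of d] unfolding fermi_sign_def has_parity_def by (auto split: if_splits)
        then show ?thesis unfolding * by (auto simp: koszul_sign_def)
      qed (simp add: *)
    qed
    show "star (\<iota> (Suc n) d) = \<iota> (Suc n) (star d)" if "has_parity \<beta> q d" for n d q
      using starten[OF hom1(1) par[OF that]] by (simp add: one_ten \<theta>_simps)
    show "S n \<subseteq> S (Suc n)" for n
      using tenS[of _ n 1] ten_1[of _ n] by fastforce
    show "\<iota> (Suc n) d \<in> S (Suc n)" for n d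
      using tenS[OF one, of n d] by (simp add: one_ten)
    show "clinear_on UNIV (ten n 1)" for n by (rule lin1[OF one])
  qed (fact iso0 \<theta>0 \<theta>ten one_ten lin1 lin2 cl sub \<theta>S one dense)+
qed

lemma \<theta>_\<iota>: "\<theta> (\<iota> j b) = \<iota> j (\<beta> b)"
  by (rule tower, cases j) (simp_all, metis \<theta>_simps(5))

lemma clinear_\<iota>: "clinear_on UNIV (\<iota> j)"
proof (rule tower)
  fix S :: "nat \<Rightarrow> 'a set" and ten
  assume "star_isomorphism UNIV (S 0) (\<iota> 0)" "\<And>n. clinear_on UNIV (ten n 1)" "\<And>n d. ten n 1 d = \<iota> (Suc n) d"
  then show ?thesis by (cases j) (simp_all add: star_isomorphism_def clinear_on_def)
qed

lemma \<iota>_add: "\<iota> j (b + c) = \<iota> j b + \<iota> j c" and \<iota>_scale: "\<iota> j (z *\<^sub>C b) = z *\<^sub>C \<iota> j b"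
  using clinear_\<iota>[of j] by (auto simp: clinear_on_def)

lemma \<iota>_minus: "\<iota> j (- b) = - \<iota> j b"
  using \<iota>_scale[of j "-1" b] by simp

lemma \<iota>_parity: "has_parity \<beta> p b \<Longrightarrow> has_parity \<theta> p (\<iota> j b)"
  by (auto simp: has_parity_def \<theta>_\<iota> \<iota>_minus)

lemma star_\<iota>: "has_parity \<beta> p b \<Longrightarrow> star (\<iota> j b) = \<iota> j (star b)"
  by (rule tower, cases j) (auto simp: star_isomorphism_def)

lemma star_parity: "has_parity \<beta> p b \<Longrightarrow> has_parity \<beta> p (star b)"
  by (auto simp: has_parity_def \<beta>_simps star_minus)

text \<open>The factor with the smaller index lies in the power to which the other factor is adjoined, so that the
product rule for elementary tensors applies.\<close>

lemma \<iota>_graded_commute: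
  assumes "i \<noteq> j" and a: "has_parity \<beta> p a" and b: "has_parity \<beta> q b"
  shows "\<iota> i a * \<iota> j b = koszul_sign p q * (\<iota> j b * \<iota> i a)"
proof (rule tower)
  fix S :: "nat \<Rightarrow> 'a set" and ten
  assume S0: "star_isomorphism UNIV (S 0) (\<iota> 0)"
    and inc: "\<And>n. S n \<subseteq> S (Suc n)" and \<iota>S: "\<And>n d. \<iota> (Suc n) d \<in> S (Suc n)"
    and ten: "\<And>n c p d q. c \<in> S n \<Longrightarrow> has_parity \<theta> p c \<Longrightarrow> has_parity \<beta> q d \<Longrightarrow>
        ten n c d = c * \<iota> (Suc n) d \<and> \<iota> (Suc n) d * c = koszul_sign p q * ten n c d"
  have inS: "\<iota> i a \<in> S n" if "i \<le> n" for i n a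
  proof -
    have "\<iota> i a \<in> S i"
      using S0 \<iota>S by (cases i) (auto simp: star_isomorphism_def bij_betw_def)
    then show ?thesis using lift_Suc_mono_le[of S, OF inc that] by blast
  qed
  have less: "\<iota> j b * \<iota> i a = koszul_sign p q * (\<iota> i a * \<iota> j b)"
    if "i < j" "has_parity \<beta> p a" "has_parity \<beta> q b" for i j p q a b
  proof -
    obtain n where n: "j = Suc n" "i \<le> n" using \<open>i < j\<close> by (cases j) auto
    show ?thesis using ten[OF inS[OF n(2)] \<iota>_parity[OF that(2)] that(3)] by (auto simp: n)
  qed
  show ?thesis
  proof (cases "i < j")
    case True
    show ?thesis unfolding less[OF True a b] by (simp add: koszul_sign_def)
  next
    case False
    then have "j < i" using \<open>i \<noteq> j\<close> by simp
    then show ?thesis unfolding less[OF \<open>j < i\<close> b a] by (simp add: koszul_sign_def)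
  qed
qed


lemma monomial_\<iota>_commute:
  assumes "fermi_monomial \<beta> \<iota> I p x" and j: "j \<notin> I" and b: "has_parity \<beta> q b"
  shows "x * \<iota> j b = koszul_sign p q * (\<iota> j b * x)"
  using assms(1)
proof (induction rule: fermi_monomial.induct)
  case (factor k p' b' r x)
  have "k \<noteq> j" using factor.hyps j by auto
  have "\<iota> k b' * x * \<iota> j b = \<iota> k b' * (koszul_sign r q * (\<iota> j b * x))"
    by (simp add: mult.assoc factor.IH)
  also have "\<dots> = koszul_sign r q * ((\<iota> k b' * \<iota> j b) * x)"
    by (simp add: koszul_sign_def mult.assoc)
  also have "\<dots> = koszul_sign (p' \<noteq> r) q * (\<iota> j b * (\<iota> k b' * x))"
    unfolding \<iota>_graded_commute[OF \<open>k \<noteq> j\<close> factor.hyps(2) b] by (auto simp: koszul_sign_def mult.assoc)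
  finally show ?case .
qed simp

lemma monomial_commute:
  assumes x: "fermi_monomial \<beta> \<iota> I p x" and "fermi_monomial \<beta> \<iota> J q y" and "I \<inter> J = {}"
  shows "x * y = koszul_sign p q * (y * x)"
  using assms(2)
proof (induction rule: fermi_monomial.induct)
  case (factor k q' b r y)
  have "k \<notin> I" using factor.hyps assms(3) by auto
  have "x * (\<iota> k b * y) = (x * \<iota> k b) * y"
    by (simp add: mult.assoc)
  also have "\<dots> = koszul_sign p q' * (\<iota> k b * (x * y))"
    unfolding monomial_\<iota>_commute[OF x \<open>k \<notin> I\<close> factor.hyps(2)] by (simp add: mult.assoc)
  also have "\<dots> = koszul_sign p (q' \<noteq> r) * (\<iota> k b * y * x)"
    unfolding factor.IH by (auto simp: koszul_sign_def mult.assoc)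
  finally show ?case .
qed simp

lemma monomial_star: "fermi_monomial \<beta> \<iota> I p x \<Longrightarrow> fermi_monomial \<beta> \<iota> I p (star x)"
proof (induction rule: fermi_monomial.induct)
  case (factor k p b q x)
  have "fermi_monomial \<beta> \<iota> I (p \<noteq> False) (\<iota> k (star b) * 1)"
    by (intro fermi_monomial.intros factor star_parity)
  from fermi_monomial_mult[OF factor.IH this] show ?case
    using factor.hyps by (simp add: star_mult star_\<iota> eq_commute)
qed (simp add: fermi_monomial.one)

lemma monomial_parity: "fermi_monomial \<beta> \<iota> I p x \<Longrightarrow> has_parity \<theta> p x"
proof (induction rule: fermi_monomial.induct)
  case (factor k p b q x)
  then show ?case using \<iota>_parity[OF factor.hyps(2), of k]
    by (auto simp: has_parity_def \<theta>_simps)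
qed (simp add: has_parity_def \<theta>_simps)

text \<open>Stated as an induction principle, in which \<open>V\<close> consists of the elements with the property to be proved.
The least closed subspace \<open>K\<close> that contains the monomials is stable under right multiplication by every
\<open>\<iota> j b\<close>: for homogeneous \<open>b\<close> its preimage under this multiplication is again a closed subspace that
contains the monomials. Hence \<open>K\<close> absorbs one Fermi power after the other.\<close>

lemma monomials_dense:
  assumes V: "closed V" "complex_vector.subspace V"
    and mono: "\<And>p x. fermi_monomial \<beta> \<iota> UNIV p x \<Longrightarrow> x \<in> V"
  shows "x \<in> V"
proof -
  define \<V> where "\<V> = {V :: 'a set. closed V \<and> complex_vector.subspace V \<and>
    (\<forall>p x. fermi_monomial \<beta> \<iota> UNIV p x \<longrightarrow> x \<in> V)}"
  define K where "K = \<Inter>\<V>"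
  have K: "closed K" "complex_vector.subspace K" "\<And>p x. fermi_monomial \<beta> \<iota> UNIV p x \<Longrightarrow> x \<in> K"
    by (auto simp: K_def \<V>_def intro!: complex_vector.subspace_Inter)
  have least: "K \<subseteq> W" if "closed W" "complex_vector.subspace W"
    "\<And>p x. fermi_monomial \<beta> \<iota> UNIV p x \<Longrightarrow> x \<in> W" for W
    using that by (auto simp: K_def \<V>_def)
  have add: "x + y \<in> K" if "x \<in> K" "y \<in> K" for x y
    using complex_vector.subspace_add[OF K(2)] that by blast
  have mult_hom: "c * \<iota> j b \<in> K" if "c \<in> K" "has_parity \<beta> p b" for c j p b
  proof -
    have "K \<subseteq> {c. c * \<iota> j b \<in> K}"
    proof (rule least)
      show "closed {c. c * \<iota> j b \<in> K}"
        using continuous_closed_vimage[OF K(1), of "\<lambda>c. c * \<iota> j b"]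
        by (simp add: vimage_def continuous_intros)
      show "complex_vector.subspace {c. c * \<iota> j b \<in> K}"
        using K(2) by (auto simp: complex_vector.subspace_def distrib_right mult_scaleC_left)
      fix q x assume x: "fermi_monomial \<beta> \<iota> UNIV q x"
      have "fermi_monomial \<beta> \<iota> UNIV (p \<noteq> False) (\<iota> j b * 1)"
        by (intro fermi_monomial.intros that UNIV_I)
      from fermi_monomial_mult[OF x this] show "x \<in> {c. c * \<iota> j b \<in> K}"
        using K(3) by simp
    qed
    then show ?thesis using \<open>c \<in> K\<close> by blast
  qed
  note dec\<beta> = parity_decomposition[OF \<beta>_iso \<beta>_\<beta>] and dec\<theta> = parity_decomposition[OF \<theta>_iso \<theta>_\<theta>]
  have mult: "c * \<iota> j b \<in> K" if "c \<in> K" for c j b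
    using add[OF mult_hom[OF that dec\<beta>(1)[of b]] mult_hom[OF that dec\<beta>(2)[of b]], of j j]
    unfolding dec\<beta>(3) \<iota>_add[symmetric] distrib_left[symmetric] .
  have "1 \<in> K" by (rule K(3)) (rule fermi_monomial.one)
  have "K = UNIV"
  proof (rule tower)
    fix S :: "nat \<Rightarrow> 'a set" and ten
    assume S0: "star_isomorphism UNIV (S 0) (\<iota> 0)"
      and ten: "\<And>n c p d q. c \<in> S n \<Longrightarrow> has_parity \<theta> p c \<Longrightarrow> has_parity \<beta> q d \<Longrightarrow>
        ten n c d = c * \<iota> (Suc n) d \<and> \<iota> (Suc n) d * c = koszul_sign p q * ten n c d"
      and lin1: "\<And>n c. c \<in> S n \<Longrightarrow> clinear_on UNIV (ten n c)"
      and lin2: "\<And>n d. clinear_on (S n) (\<lambda>c. ten n c d)"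
      and cl: "\<And>n. S (Suc n) = closure (complex_vector.span {ten n c d | c d. c \<in> S n})"
      and sub: "\<And>n. complex_vector.subspace (S n)" and \<theta>S: "\<And>n c. c \<in> S n \<Longrightarrow> \<theta> c \<in> S n"
      and dense: "closure (\<Union>n. S n) = UNIV"
    have "S n \<subseteq> K" for n
    proof (induction n)
      case 0
      have "range (\<iota> 0) \<subseteq> K" using mult[OF \<open>1 \<in> K\<close>, of 0] by auto
      then show ?case using S0 by (simp add: star_isomorphism_def bij_betw_def)
    next
      case (Suc n)
      have "ten n c d \<in> K" if c: "c \<in> S n" for c d
      proof -
        have S: "even_part \<theta> c \<in> S n" "odd_part \<theta> c \<in> S n"
          using sub[of n] c \<theta>S[OF c] unfolding even_part_def odd_part_def
          by (auto intro: complex_vector.subspace_scale complex_vector.subspace_add complex_vector.subspace_diff)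
        have hom: "ten n c d = c * \<iota> (Suc n) d" if "has_parity \<beta> q d" for d q
        proof -
          have "ten n c d = ten n (even_part \<theta> c) d + ten n (odd_part \<theta> c) d"
            using lin2[of n d] S dec\<theta>(3)[of c] unfolding clinear_on_def by metis
          also have "\<dots> = (even_part \<theta> c + odd_part \<theta> c) * \<iota> (Suc n) d"
            using ten[OF S(1) dec\<theta>(1) that] ten[OF S(2) dec\<theta>(2) that] by (simp add: distrib_right)
          finally show ?thesis by (simp add: dec\<theta>(3))
        qed
        have "ten n c d = ten n c (even_part \<beta> d) + ten n c (odd_part \<beta> d)"
          using lin1[OF c] dec\<beta>(3)[of d] unfolding clinear_on_def by (metis UNIV_I)
        also have "\<dots> \<in> K"
          using hom[OF dec\<beta>(1)] hom[OF dec\<beta>(2)] mult Suc.IH c by (auto intro!: add)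
        finally show ?thesis .
      qed
      then show ?case unfolding cl
        by (intro closure_minimal complex_vector.span_minimal K) auto
    qed
    then have "closure (\<Union>n. S n) \<subseteq> K" by (intro closure_minimal K) auto
    then show ?thesis using dense by auto
  qed
  moreover have "K \<subseteq> V" by (rule least) (use assms in auto)
  ultimately show ?thesis by blast
qed

end

locale permuted_fermi_product = fermi_product \<beta> \<iota> \<theta>
  for \<beta> :: "'b::cstar_algebra \<Rightarrow> 'b" and \<iota> :: "nat \<Rightarrow> 'b \<Rightarrow> 'a::cstar_algebra" and \<theta> +
  fixes \<alpha> :: "nat perm \<Rightarrow> 'a \<Rightarrow> 'a"
  assumes action: "permutation_action \<iota> \<alpha>"
begin

lemma \<alpha>_iso: "star_isomorphism UNIV UNIV (\<alpha> g)" and \<alpha>_\<iota>: "\<alpha> g (\<iota> j b) = \<iota> (Perm.apply g j) b"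
  using action by (auto simp: permutation_action_def)

lemmas \<alpha>_simps = star_isomorphismD[OF \<alpha>_iso]

lemma \<alpha>_monomial:
  "fermi_monomial \<beta> \<iota> I p x \<Longrightarrow> fermi_monomial \<beta> \<iota> (Perm.apply g ` I) p (\<alpha> g x)"
proof (induction rule: fermi_monomial.induct)
  case (factor k p b q x)
  then show ?case unfolding \<alpha>_simps \<alpha>_\<iota> by (blast intro: fermi_monomial.factor)
qed (simp add: \<alpha>_simps fermi_monomial.one)

lemma \<alpha>_fixes_monomial:
  "\<lbrakk>fermi_monomial \<beta> \<iota> I p x; \<And>i. i \<in> I \<Longrightarrow> Perm.apply g i = i\<rbrakk> \<Longrightarrow> \<alpha> g x = x"
  by (induction rule: fermi_monomial.induct) (auto simp: \<alpha>_simps \<alpha>_\<iota>)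

text \<open>The action is specified only through \<open>\<iota>\<close>, and so its multiplicativity in the group element is obtained on
monomials first.\<close>

lemma \<alpha>_times_monomial:
  "fermi_monomial \<beta> \<iota> I p x \<Longrightarrow> \<alpha> (g * h) x = \<alpha> g (\<alpha> h x)"
  by (induction rule: fermi_monomial.induct) (auto simp: \<alpha>_simps \<alpha>_\<iota> apply_times)

end

section \<open>Means over Folner sequences\<close>

text \<open>The permutation number \<open>n\<close> exchanges \<open>I\<close> with its translate by \<open>(n + 1) * M\<close>, where \<open>M\<close> bounds \<open>I\<close> and \<open>J\<close>.\<close>

lemma finite_permutation_moving_away:
  fixes I J :: "nat set"
  assumes "finite I" "finite J" "I \<inter> J = {}"
  shows "\<exists>k :: nat \<Rightarrow> nat perm. (\<forall>n. \<forall>j\<in>J. Perm.apply (k n) j = j) \<and>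
    (\<forall>m n. m \<noteq> n \<longrightarrow> Perm.apply (k m) ` I \<inter> Perm.apply (k n) ` I = {})"
proof -
  obtain M where M: "I \<union> J \<subseteq> {..<M}"
    using finite_nat_bounded[of "I \<union> J"] assms by auto
  define f where "f n x = (if x \<in> I then x + Suc n * M
      else if Suc n * M \<le> x \<and> x - Suc n * M \<in> I then x - Suc n * M else x)" for n x
  have notI: "x + Suc n * M \<notin> I" for n x using M by auto
  have inv: "f n (f n x) = x" for n x
    using notI[of "x - Suc n * M" n] notI[of x n] by (auto simp: f_def)
  have "bij (f n)" for n by (rule o_bij[of "f n"]) (auto simp: inv)
  moreover have "finite {x. f n x \<noteq> x}" for n
  proof (rule finite_subset)
    show "{x. f n x \<noteq> x} \<subseteq> I \<union> (\<lambda>x. x + Suc n * M) ` I"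
      by (auto simp: f_def split: if_splits intro: rev_image_eqI)
  qed (simp add: assms)
  ultimately have ap: "Perm.apply (Perm (f n)) = f n" for n by (simp add: Perm_inverse)
  show ?thesis
  proof (intro exI[of _ "\<lambda>n. Perm (f n)"] conjI allI ballI impI)
    fix n j assume "j \<in> J"
    then have "j \<notin> I" "j < M" using M assms(3) by auto
    then show "Perm.apply (Perm (f n)) j = j" by (simp add: ap f_def)
  next
    fix m n :: nat assume "m \<noteq> n"
    have "(x + Suc n * M) div M = Suc n" if "x \<in> I" for x n
      using that M by (auto simp: div_mult_self1 simp del: mult_Suc)
    then have "x + Suc m * M \<noteq> y + Suc n * M" if "x \<in> I" "y \<in> I" for x y
      using that \<open>m \<noteq> n\<close> by (metis nat.inject)
    then show "Perm.apply (Perm (f m)) ` I \<inter> Perm.apply (Perm (f n)) ` I = {}"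
      by (auto simp: ap f_def)
  qed
qed

text \<open>Multiplication from the left by the transposition of \<open>j\<close> and \<open>k\<close> turns permutations with \<open>i \<mapsto> j\<close> into
permutations with \<open>i \<mapsto> k\<close>. By the Folner property, each of the sets \<open>{g. g i = k}\<close> with \<open>k < N\<close> is thus
asymptotically at least as dense as \<open>{g. g i = j}\<close>. As they are disjoint, the density of the latter is in the
limit at most \<open>1 / N\<close>, for every \<open>N\<close>.\<close>

lemma folner_site_negligible:
  assumes \<Lambda>: "folner_sequence \<Lambda>"
  shows "(\<lambda>n. real (card {g \<in> \<Lambda> n. Perm.apply g i = j}) / real (card (\<Lambda> n))) \<longlonglongrightarrow> 0"
proof -
  have fin: "finite (\<Lambda> n)" and card: "0 < card (\<Lambda> n)" for n
    using \<Lambda> by (auto simp: folner_sequence_def card_gt_0_iff)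
  define A where "A k n = {g \<in> \<Lambda> n. Perm.apply g i = k}" for k n
  define h where "h k = Perm.swap j k" for k :: nat
  define D where "D k n = sym_diff ((\<lambda>g. h k * g) ` \<Lambda> n) (\<Lambda> n)" for k n
  have inj: "inj_on (\<lambda>g. h k * g) S" for k S
    by (rule inj_onI) (metis apply_inj apply_sequence perm_eqI)
  have "card (A j n) \<le> card (A k n) + card (D k n)" for k n
  proof -
    have "(\<lambda>g. h k * g) ` A j n \<subseteq> A k n \<union> D k n"
    proof
      fix g assume "g \<in> (\<lambda>g. h k * g) ` A j n"
      then obtain g' where g': "g' \<in> \<Lambda> n" "Perm.apply g' i = j" "g = h k * g'" by (auto simp: A_def)
      then have "Perm.apply g i = k" by (simp add: apply_times h_def)
      then show "g \<in> A k n \<union> D k n" using g' by (auto simp: A_def D_def)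
    qed
    then have "card ((\<lambda>g. h k * g) ` A j n) \<le> card (A k n \<union> D k n)"
      by (rule card_mono[rotated]) (auto simp: A_def D_def fin)
    then show ?thesis using card_Un_le[of "A k n" "D k n"] card_image[OF inj[of k "A j n"]] by simp
  qed
  \<comment> \<open>The count for \<open>j\<close> is compared with those for all \<open>k < N\<close>, up to the Folner errors \<open>D\<close>.\<close>
  then have f1: "(\<Sum>k<N. card (A j n)) \<le> (\<Sum>k<N. card (A k n) + card (D k n))" for N n
    by (intro sum_mono)
  have f2: "(\<Sum>k<N. card (A k n)) \<le> card (\<Lambda> n)" for N n
  proof -
    have "(\<Sum>k<N. card (A k n)) = card (\<Union>k<N. A k n)"
      by (rule card_UN_disjoint[symmetric]) (auto simp: A_def fin)
    also have "\<dots> \<le> card (\<Lambda> n)" by (rule card_mono) (auto simp: A_def fin)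
    finally show ?thesis .
  qed
  have "N * card (A j n) \<le> card (\<Lambda> n) + (\<Sum>k<N. card (D k n))" for N n
    using f1[of n N] f2[of n N] by (simp add: sum.distrib)
  then have real_le: "real (N * card (A j n)) \<le> real (card (\<Lambda> n) + (\<Sum>k<N. card (D k n)))" for N n
    by (simp only: of_nat_le_iff)
  have le: "real (card (A j n)) / card (\<Lambda> n) \<le> (1 + (\<Sum>k<N. card (D k n) / card (\<Lambda> n))) / N"
    if "N > 0" for N n
  proof -
    have "real N * real (card (A j n)) \<le> real (card (\<Lambda> n)) + (\<Sum>k<N. real (card (D k n)))"
      using real_le[of N n] by simp
    moreover have "a / L \<le> (1 + S / L) / N" if "real N * a \<le> L + S" "L > 0" for a L S :: real
      using that \<open>N > 0\<close> by (simp add: field_simps)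
    ultimately show ?thesis
      using card[of n] by (simp add: sum_divide_distrib[symmetric])
  qed
  have lim: "(\<lambda>n. (1 + (\<Sum>k<N. card (D k n) / card (\<Lambda> n))) / N) \<longlonglongrightarrow> 1 / N" for N :: nat
  proof -
    have z: "(\<lambda>n. card (D k n) / card (\<Lambda> n)) \<longlonglongrightarrow> 0" for k
      using \<Lambda> by (auto simp: folner_sequence_def D_def)
    have "(\<lambda>n. (1 + (\<Sum>k<N. card (D k n) / card (\<Lambda> n))) / N) \<longlonglongrightarrow> (1 + (\<Sum>k<N. 0)) / N"
      unfolding divide_inverse[of _ "real N"]
      by (rule tendsto_mult_right[OF tendsto_add[OF tendsto_const tendsto_sum[OF z]]])
    then show ?thesis by simp
  qed
  have "(\<lambda>n. real (card (A j n)) / card (\<Lambda> n)) \<longlonglongrightarrow> 0"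
  proof (rule tendstoI)
    fix e :: real assume "e > 0"
    then obtain N :: nat where N: "N > 0" "1 / N < e"
      using reals_Archimedean[of e] by (metis inverse_eq_divide zero_less_Suc)
    from order_tendstoD(2)[OF lim this(2)]
    show "\<forall>\<^sub>F n in sequentially. dist (real (card (A j n)) / card (\<Lambda> n)) 0 < e"
      by eventually_elim (use le[OF N(1)] in \<open>auto intro: le_less_trans\<close>)
  qed
  then show ?thesis by (simp add: A_def)
qed

lemma has_mean_zero_if_vanishing:
  assumes \<Lambda>: "folner_sequence \<Lambda>" and fin: "finite I" "finite J"
    and bound: "\<And>g. cmod (f g) \<le> K"
    and zero: "\<And>g. Perm.apply g ` I \<inter> J = {} \<Longrightarrow> f g = 0"
  shows "has_mean \<Lambda> f 0"
proof -
  have fin\<Lambda>: "finite (\<Lambda> n)" for n using \<Lambda> by (auto simp: folner_sequence_def)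
  have K: "0 \<le> K" using norm_ge_zero bound order_trans by blast
  define A where "A i j n = {g \<in> \<Lambda> n. Perm.apply g i = j}" for i j n
  have le: "cmod (\<Sum>g\<in>\<Lambda> n. f g) \<le> K * (\<Sum>i\<in>I. \<Sum>j\<in>J. card (A i j n))" for n
  proof -
    let ?B = "\<Union>i\<in>I. \<Union>j\<in>J. A i j n"
    have "(\<Sum>g\<in>\<Lambda> n. f g) = (\<Sum>g\<in>?B. f g)"
      by (rule sum.mono_neutral_right) (use fin\<Lambda> zero in \<open>auto simp: A_def\<close>)
    also have "cmod \<dots> \<le> K * card ?B"
      using sum_norm_bound[of ?B f K] bound by (simp add: mult.commute)
    also have "card ?B \<le> (\<Sum>i\<in>I. \<Sum>j\<in>J. card (A i j n))"
      by (rule order_trans[OF card_UN_le[OF fin(1)]]) (intro sum_mono card_UN_le fin(2))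
    finally show ?thesis using K by (simp add: mult_left_mono)
  qed
  have "(\<lambda>n. K * (\<Sum>i\<in>I. \<Sum>j\<in>J. card (A i j n) / card (\<Lambda> n))) \<longlonglongrightarrow> K * (\<Sum>i\<in>I. \<Sum>j\<in>J. 0)"
    unfolding A_def by (intro tendsto_intros folner_site_negligible \<Lambda>)
  then have lim: "(\<lambda>n. K * (\<Sum>i\<in>I. \<Sum>j\<in>J. card (A i j n) / card (\<Lambda> n))) \<longlonglongrightarrow> 0"
    by simp
  have "cmod ((\<Sum>g\<in>\<Lambda> n. f g) / of_nat (card (\<Lambda> n)))
      \<le> K * (\<Sum>i\<in>I. \<Sum>j\<in>J. card (A i j n) / card (\<Lambda> n))" for n
  proof -
    have "cmod ((\<Sum>g\<in>\<Lambda> n. f g) / of_nat (card (\<Lambda> n))) = cmod (\<Sum>g\<in>\<Lambda> n. f g) / card (\<Lambda> n)"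
      by (simp only: norm_divide norm_of_nat)
    also have "\<dots> \<le> K * (\<Sum>i\<in>I. \<Sum>j\<in>J. card (A i j n)) / card (\<Lambda> n)"
      by (rule divide_right_mono[OF le]) simp
    finally show ?thesis by (simp only: sum_divide_distrib[symmetric] times_divide_eq_right of_nat_sum)
  qed
  then show ?thesis
    unfolding has_mean_def by (intro Lim_null_comparison[OF _ lim] always_eventually allI)
qed

lemma has_mean_zero_uniform_limit:
  assumes mean: "\<And>m. has_mean \<Lambda> (f m) 0"
    and close: "\<And>m g. cmod (h g - f m g) \<le> e m" and lim: "e \<longlonglongrightarrow> 0"
  shows "has_mean \<Lambda> h 0"
proof -
  define A where "A n f = (\<Sum>g\<in>\<Lambda> n. f g) / of_nat (card (\<Lambda> n))" for n and f :: "nat perm \<Rightarrow> complex"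
  have e: "0 \<le> e m" for m using order_trans[OF norm_ge_zero close] .
  have dist: "cmod (A n h - A n (f m)) \<le> e m" for n m
  proof -
    have "cmod (\<Sum>g\<in>\<Lambda> n. h g - f m g) \<le> card (\<Lambda> n) * e m"
      using sum_norm_bound[of "\<Lambda> n" "\<lambda>g. h g - f m g" "e m"] close by simp
    moreover have "A n h - A n (f m) = (\<Sum>g\<in>\<Lambda> n. h g - f m g) / of_nat (card (\<Lambda> n))"
      by (simp add: A_def sum_subtractf diff_divide_distrib)
    then have "cmod (A n h - A n (f m)) = cmod (\<Sum>g\<in>\<Lambda> n. h g - f m g) / card (\<Lambda> n)"
      by (simp only: norm_divide norm_of_nat)
    ultimately show ?thesis
      using e[of m] by (cases "card (\<Lambda> n) = 0") (simp_all add: divide_le_eq mult.commute)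
  qed
  have "(\<lambda>n. A n h) \<longlonglongrightarrow> 0"
  proof (rule tendstoI)
    fix r :: real assume "r > 0"
    then have "\<forall>\<^sub>F m in sequentially. e m < r / 2"
      by (intro order_tendstoD(2)[OF lim]) simp
    then obtain m where m: "e m < r / 2"
      using eventually_happens'[OF sequentially_bot] by blast
    have "(\<lambda>n. A n (f m)) \<longlonglongrightarrow> 0" using mean[of m] by (simp add: has_mean_def A_def)
    from tendstoD[OF this, of "r / 2"] \<open>r > 0\<close>
    have "\<forall>\<^sub>F n in sequentially. cmod (A n (f m)) < r / 2" by simp
    then show "\<forall>\<^sub>F n in sequentially. dist (A n h) 0 < r"
    proof eventually_elim
      case (elim n)
      have "cmod (A n h) \<le> cmod (A n (f m)) + cmod (A n h - A n (f m))"
        using norm_triangle_ineq[of "A n (f m)" "A n h - A n (f m)"] by simp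
      then show ?case using elim m dist[of n m] by simp
    qed
  qed
  then show ?thesis by (simp add: has_mean_def A_def)
qed

text \<open>A bound that is uniform in \<open>g\<close> makes the vanishing of the mean a closed condition, as \<open>monomials_dense\<close>
requires.\<close>

lemma has_mean_zero_closed_subspace:
  fixes F :: "nat perm \<Rightarrow> 'a::cstar_algebra \<Rightarrow> complex"
  assumes lin: "\<And>g. clinear_on UNIV (F g)" and bound: "\<And>g x. cmod (F g x) \<le> K * norm x"
  shows "closed {x. has_mean \<Lambda> (\<lambda>g. F g x) 0}" "complex_vector.subspace {x. has_mean \<Lambda> (\<lambda>g. F g x) 0}"
proof -
  have add: "F g (x + y) = F g x + F g y" and scale: "F g (z *\<^sub>C x) = z * F g x" for g x y z
    using lin[of g] by (auto simp: clinear_on_def scaleC_complex_def)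
  define A where "A n x = (\<Sum>g\<in>\<Lambda> n. F g x) / of_nat (card (\<Lambda> n))" for n x
  have mean: "has_mean \<Lambda> (\<lambda>g. F g x) 0 \<longleftrightarrow> (\<lambda>n. A n x) \<longlonglongrightarrow> 0" for x
    by (simp add: has_mean_def A_def)
  have A_add: "A n (x + y) = A n x + A n y" and A_scale: "A n (z *\<^sub>C x) = z * A n x" for n x y z
    by (simp_all add: A_def add scale sum.distrib add_divide_distrib sum_distrib_left)
  show "complex_vector.subspace {x. has_mean \<Lambda> (\<lambda>g. F g x) 0}"
  proof (rule complex_vector.subspaceI)
    show "0 \<in> {x. has_mean \<Lambda> (\<lambda>g. F g x) 0}" using A_scale[of _ 0 0] by (simp add: mean)
  qed (auto simp: mean A_add A_scale intro: tendsto_add_zero tendsto_mult_right_zero)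
  show "closed {x. has_mean \<Lambda> (\<lambda>g. F g x) 0}"
    unfolding closed_sequential_limits
  proof (intro allI impI, elim conjE)
    fix X x assume X: "\<forall>m. X m \<in> {x. has_mean \<Lambda> (\<lambda>g. F g x) 0}" and lim: "X \<longlonglongrightarrow> x"
    have "(\<lambda>m. K * norm (x - X m)) \<longlonglongrightarrow> K * norm (x - x)"
      by (intro tendsto_intros lim)
    then have lim0: "(\<lambda>m. K * norm (x - X m)) \<longlonglongrightarrow> 0" by simp
    have "F g x - F g (X m) = F g (x - X m)" for g m
      using add[of g "X m" "x - X m"] by simp
    then have "cmod (F g x - F g (X m)) \<le> K * norm (x - X m)" for g m
      using bound[of g "x - X m"] by simp
    then have "has_mean \<Lambda> (\<lambda>g. F g x) 0"
      by (rule has_mean_zero_uniform_limit[where f="\<lambda>m g. F g (X m)", rotated]) (use X lim0 in auto)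
    then show "x \<in> {x. has_mean \<Lambda> (\<lambda>g. F g x) 0}" by simp
  qed
qed

section \<open>Symmetric states\<close>

locale symmetric_fermi_state = permuted_fermi_product \<beta> \<iota> \<theta> \<alpha>
  for \<beta> :: "'b::cstar_algebra \<Rightarrow> 'b" and \<iota> :: "nat \<Rightarrow> 'b \<Rightarrow> 'a::cstar_algebra" and \<theta> \<alpha> +
  fixes \<omega> :: "'a \<Rightarrow> complex"
  assumes symmetric: "symmetric_state \<alpha> \<omega>"
begin

sublocale positive_functional \<omega>
  using symmetric by unfold_locales (auto simp: symmetric_state_def state_on_def)

lemma \<omega>_1: "\<omega> 1 = 1"
  using symmetric by (auto simp: symmetric_state_def state_on_def)

lemma \<omega>_\<alpha>: "\<omega> (\<alpha> g x) = \<omega> x"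
  using symmetric by (auto simp: symmetric_state_def fun_eq_iff)

text \<open>The bound is uniform in \<open>g\<close> because \<open>z \<mapsto> \<omega> (star y * \<alpha> g z * y)\<close> is a positive functional, which is bounded
by its value \<open>\<omega> (star y * y)\<close> at 1.\<close>

lemma translate_bound: "cmod (\<omega> (c * \<alpha> g x * y)) \<le> norm c * norm x * norm y"
proof -
  interpret y: positive_functional "\<lambda>z. \<omega> (star y * \<alpha> g z * y)"
  proof
    show "clinear_on UNIV (\<lambda>z. \<omega> (star y * \<alpha> g z * y))"
      by (auto simp: clinear_on_def \<alpha>_simps algebra_simps mult_scaleC_left mult_scaleC_right
          add scale scaleC_complex_def)
    show "\<omega> (star y * \<alpha> g (star x * x) * y) \<in> \<real>\<^sub>\<ge>\<^sub>0" for x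
      using positive[of "\<alpha> g x * y"] by (simp add: \<alpha>_simps star_mult mult.assoc)
  qed
  have "(cmod (\<omega> (c * \<alpha> g x * y)))\<^sup>2 \<le>
      Re (\<omega> (star (star c) * star c)) * Re (\<omega> (star y * \<alpha> g (star x * x) * y))"
    using cauchy_schwarz[of "star c" "\<alpha> g x * y"] by (simp add: \<alpha>_simps star_mult star_star mult.assoc)
  also have "\<dots> \<le> (norm c)\<^sup>2 * ((norm y)\<^sup>2 * (norm x)\<^sup>2)"
  proof (intro mult_mono)
    show "Re (\<omega> (star (star c) * star c)) \<le> (norm c)\<^sup>2"
      using square_bound[of "star c"] by (simp add: \<omega>_1)
    have "Re (\<omega> (star y * \<alpha> g 1 * y)) \<le> (norm y)\<^sup>2"
      using square_bound[of y] by (simp add: \<omega>_1 \<alpha>_simps)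
    from mult_right_mono[OF this] show "Re (\<omega> (star y * \<alpha> g (star x * x) * y)) \<le> (norm y)\<^sup>2 * (norm x)\<^sup>2"
      using y.square_bound[of x] by (meson order_trans zero_le_power2)
  qed (use y.nonneg in auto)
  also have "\<dots> = (norm c * norm x * norm y)\<^sup>2" by (simp add: power_mult_distrib)
  finally show ?thesis by (rule power2_le_imp_le) simp
qed

text \<open>The copies \<open>x n\<close> of \<open>a\<close> sit on pairwise disjoint sites away from \<open>J\<close>, and between \<open>c\<close> and \<open>y\<close> the state does
not distinguish \<open>x n\<close> from \<open>a\<close>. Since odd monomials on disjoint sites anticommute, the \<open>\<omega>\<close>-length of
\<open>(x 0 + \<dots> + x (N - 1)) * y\<close> is at most of the order of the square root of \<open>N\<close>, whereas the sum of the
\<open>\<omega> (c * x n * y)\<close> is \<open>N\<close> times the same value.\<close>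

lemma odd_monomial_vanishes:
  assumes a: "fermi_monomial \<beta> \<iota> I True a" and c: "fermi_monomial \<beta> \<iota> J p c"
    and y: "fermi_monomial \<beta> \<iota> J q y" and fin: "finite I" "finite J" and dis: "I \<inter> J = {}"
  shows "\<omega> (c * a * y) = 0"
proof -
  obtain k :: "nat \<Rightarrow> nat perm"
    where k: "(\<forall>n. \<forall>j\<in>J. Perm.apply (k n) j = j) \<and>
      (\<forall>m n. m \<noteq> n \<longrightarrow> Perm.apply (k m) ` I \<inter> Perm.apply (k n) ` I = {})"
    using finite_permutation_moving_away[OF fin dis] by (rule exE)
  have fix_J: "Perm.apply (k n) j = j" if "j \<in> J" for n j
    using k that by blast
  have away: "Perm.apply (k m) ` I \<inter> Perm.apply (k n) ` I = {}" if "m \<noteq> n" for m n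
    using k that by blast
  define x where "x n = \<alpha> (k n) a" for n
  define D where "D = Re (\<omega> (star (star c) * star c))"
  define C where "C = Re (\<omega> (star y * (star a * a + a * star a) * y))"
  have fixed: "\<alpha> (k n) c = c" "\<alpha> (k n) y = y" for n
    by (rule \<alpha>_fixes_monomial[OF c fix_J] \<alpha>_fixes_monomial[OF y fix_J], assumption)+
  have cay: "\<omega> (c * x n * y) = \<omega> (c * a * y)" for n
    using \<omega>_\<alpha>[of "k n" "c * a * y"] by (simp add: \<alpha>_simps fixed x_def)
  have diag: "Re (\<omega> (star y * (star (x n) * x n + x n * star (x n)) * y)) = C" for n
    using \<omega>_\<alpha>[of "k n" "star y * (star a * a + a * star a) * y"]
    by (simp add: \<alpha>_simps fixed x_def C_def)
  have xmono: "fermi_monomial \<beta> \<iota> (Perm.apply (k n) ` I) True (x n)" for n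
    unfolding x_def by (rule \<alpha>_monomial[OF a])
  have anti: "star (x m) * x n + x n * star (x m) = 0" if "m \<noteq> n" for m n
    using monomial_commute[OF monomial_star[OF xmono] xmono away[OF that]] by simp
  have main: "real N * (cmod (\<omega> (c * a * y)))\<^sup>2 \<le> D * C" if "N > 0" for N :: nat
  proof -
    define X where "X = (\<Sum>n<N. x n)"
    have starX: "star X = (\<Sum>n<N. star (x n))"
      unfolding X_def by (rule linear_sum[OF bounded_linear.linear[OF bounded_linear_star]])
    \<comment> \<open>The summand \<open>X * star X\<close> turns all off-diagonal terms into anticommutators, which vanish.\<close>
    have "star X * X + X * star X = (\<Sum>m<N. \<Sum>n<N. star (x m) * x n) + (\<Sum>m<N. \<Sum>n<N. x n * star (x m))"
      unfolding starX unfolding X_def sum_product by (subst (2) sum.swap) simp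
    also have "\<dots> = (\<Sum>m<N. \<Sum>n<N. star (x m) * x n + x n * star (x m))"
      by (simp add: sum.distrib)
    also have "\<dots> = (\<Sum>m<N. \<Sum>n<N. if n = m then star (x m) * x m + x m * star (x m) else 0)"
      by (intro sum.cong refl) (auto simp: anti)
    also have "\<dots> = (\<Sum>m<N. star (x m) * x m + x m * star (x m))" by simp
    finally have sq: "star X * X + X * star X = (\<Sum>m<N. star (x m) * x m + x m * star (x m))" .
    have "\<omega> (star y * (star X * X + X * star X) * y)
        = (\<Sum>m<N. \<omega> (star y * (star (x m) * x m + x m * star (x m)) * y))"
      unfolding sq sum_distrib_left sum_distrib_right sum ..
    then have "Re (\<omega> (star y * (star X * X + X * star X) * y)) = real N * C"
      by (simp add: diag)
    moreover have "\<omega> (star y * (star X * X + X * star X) * y)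
        = \<omega> (star (X * y) * (X * y)) + \<omega> (star (star X * y) * (star X * y))"
      by (simp add: algebra_simps star_mult star_star add)
    ultimately have Xy: "Re (\<omega> (star (X * y) * (X * y))) \<le> real N * C"
      using nonneg[of "star X * y"] by simp
    have "c * X * y = (\<Sum>n<N. c * x n * y)"
      by (simp add: X_def sum_distrib_left sum_distrib_right)
    then have "\<omega> (c * X * y) = of_nat N * \<omega> (c * a * y)" by (simp add: sum cay)
    then have "(real N * cmod (\<omega> (c * a * y)))\<^sup>2 = (cmod (\<omega> (star (star c) * (X * y))))\<^sup>2"
      by (simp add: norm_mult star_star mult.assoc)
    also have "\<dots> \<le> D * Re (\<omega> (star (X * y) * (X * y)))"
      unfolding D_def by (rule cauchy_schwarz)
    also have "\<dots> \<le> D * (real N * C)"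
      using Xy nonneg[of "star c"] by (intro mult_left_mono) (auto simp: D_def)
    finally have "real N * (real N * (cmod (\<omega> (c * a * y)))\<^sup>2) \<le> real N * (D * C)"
      by (simp add: power2_eq_square algebra_simps)
    then show ?thesis using that by simp
  qed
  show ?thesis
  proof (rule ccontr)
    assume "\<omega> (c * a * y) \<noteq> 0"
    then have pos: "(cmod (\<omega> (c * a * y)))\<^sup>2 > 0" by simp
    obtain N :: nat where "D * C < real N * (cmod (\<omega> (c * a * y)))\<^sup>2"
      using reals_Archimedean3[OF pos] by blast
    moreover have "real N * (cmod (\<omega> (c * a * y)))\<^sup>2 \<le> real (Suc N) * (cmod (\<omega> (c * a * y)))\<^sup>2"
      by (rule mult_right_mono) auto
    ultimately show False using main[of "Suc N"] by simp
  qed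
qed

text \<open>Both \<open>\<omega>\<close> and \<open>\<omega> \<circ> \<theta>\<close> are positive functionals and hence continuous, so that monomials suffice.\<close>

lemma \<omega>_even: "\<omega> (\<theta> x) = \<omega> x"
proof -
  interpret \<theta>: positive_functional "\<lambda>x. \<omega> (\<theta> x)"
    using linear positive by unfold_locales (auto simp: clinear_on_def \<theta>_simps)
  have cont: "continuous_on UNIV \<phi>" if "positive_functional \<phi>" for \<phi> :: "'a \<Rightarrow> complex"
  proof -
    interpret positive_functional \<phi> by fact
    have "bounded_linear \<phi>"
    proof (rule bounded_linear_intro[where K="Re (\<phi> 1)"])
      show "\<phi> (r *\<^sub>R x) = r *\<^sub>R \<phi> x" for r x
        unfolding scaleR by (rule scaleR_conv_of_real[symmetric])
    qed (use bound in \<open>auto simp: add mult.commute\<close>)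
    then show ?thesis by (rule linear_continuous_on)
  qed
  have "x \<in> {x. \<omega> (\<theta> x) = \<omega> x}"
  proof (rule monomials_dense)
    show "closed {x. \<omega> (\<theta> x) = \<omega> x}"
      by (intro closed_Collect_eq cont) unfold_locales
    show "complex_vector.subspace {x. \<omega> (\<theta> x) = \<omega> x}"
      by (auto simp: complex_vector.subspace_def \<theta>.zero \<theta>.add \<theta>.scale add scale)
    fix p x assume "fermi_monomial \<beta> \<iota> UNIV p x"
    then obtain I where I: "finite I" "fermi_monomial \<beta> \<iota> I p x"
      using fermi_monomial_finite_sites by blast
    show "x \<in> {x. \<omega> (\<theta> x) = \<omega> x}"
    proof (cases p)
      case True
      then have "\<omega> (1 * x * 1) = 0"
        using I by (intro odd_monomial_vanishes[of I x "{}" False _ False]) (auto intro: fermi_monomial.one)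
      then show ?thesis using monomial_parity[OF I(2)] True by (simp add: has_parity_def minus)
    qed (use monomial_parity[OF I(2)] in \<open>simp add: has_parity_def\<close>)
  qed
  then show ?thesis by simp
qed

lemma commutator_bound:
  "cmod (\<omega> (c * (\<alpha> g a * b - b * \<alpha> g a) * d)) \<le> 2 * (norm a * norm b * norm c * norm d)"
proof -
  have "\<omega> (c * (\<alpha> g a * b - b * \<alpha> g a) * d) = \<omega> (c * \<alpha> g a * (b * d)) - \<omega> ((c * b) * \<alpha> g a * d)"
    by (simp only: right_diff_distrib left_diff_distrib mult.assoc diff)
  also have "cmod \<dots> \<le> norm c * norm a * norm (b * d) + norm (c * b) * norm a * norm d"
    by (rule order_trans[OF norm_triangle_ineq4 add_mono[OF translate_bound translate_bound]])
  also have "\<dots> \<le> norm c * norm a * (norm b * norm d) + (norm c * norm b) * norm a * norm d"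
    by (intro add_mono mult_left_mono mult_right_mono norm_mult_ineq) auto
  finally show ?thesis by (simp add: algebra_simps)
qed

lemma monomial_commutator_mean:
  assumes "folner_sequence \<Lambda>"
    and "fermi_monomial \<beta> \<iota> UNIV p a" "fermi_monomial \<beta> \<iota> UNIV q b"
      "fermi_monomial \<beta> \<iota> UNIV r c" "fermi_monomial \<beta> \<iota> UNIV s d"
  shows "has_mean \<Lambda> (\<lambda>g. \<omega> (c * (\<alpha> g a * b - b * \<alpha> g a) * d)) 0"
proof -
  obtain I where I: "finite I" "fermi_monomial \<beta> \<iota> I p a"
    using fermi_monomial_finite_sites[OF assms(2)] by blast
  obtain Jb Jc Jd where J': "finite Jb" "fermi_monomial \<beta> \<iota> Jb q b"
    "finite Jc" "fermi_monomial \<beta> \<iota> Jc r c" "finite Jd" "fermi_monomial \<beta> \<iota> Jd s d"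
    using assms(3-5)[THEN fermi_monomial_finite_sites] by metis
  define J where "J = Jb \<union> Jc \<union> Jd"
  have J: "finite J" "fermi_monomial \<beta> \<iota> J q b" "fermi_monomial \<beta> \<iota> J r c" "fermi_monomial \<beta> \<iota> J s d"
    using J' by (auto simp: J_def intro: fermi_monomial_mono)
  show ?thesis
  proof (rule has_mean_zero_if_vanishing[OF assms(1) I(1) J(1)])
    fix g assume dis: "Perm.apply g ` I \<inter> J = {}"
    have ga: "fermi_monomial \<beta> \<iota> (Perm.apply g ` I) p (\<alpha> g a)" by (rule \<alpha>_monomial[OF I(2)])
    show "\<omega> (c * (\<alpha> g a * b - b * \<alpha> g a) * d) = 0"
    proof (cases p)
      case True
      then have ga: "fermi_monomial \<beta> \<iota> (Perm.apply g ` I) True (\<alpha> g a)" using ga by simp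
      have fin: "finite (Perm.apply g ` I)" using I by simp
      have "\<omega> (c * \<alpha> g a * (b * d)) = 0"
        by (rule odd_monomial_vanishes[OF ga J(3) fermi_monomial_mult[OF J(2,4)] fin J(1) dis])
      moreover have "\<omega> ((c * b) * \<alpha> g a * d) = 0"
        by (rule odd_monomial_vanishes[OF ga fermi_monomial_mult[OF J(3,2)] J(4) fin J(1) dis])
      ultimately show ?thesis by (simp add: right_diff_distrib left_diff_distrib mult.assoc diff)
    next
      case False
      then show ?thesis using monomial_commute[OF ga J(2) dis] by simp
    qed
  qed (rule commutator_bound)
qed

text \<open>The expression is linear in each of the four elements and bounded uniformly in \<open>g\<close>, and so the monomials can
be replaced by arbitrary elements in one variable at a time.\<close>

lemma asymptotically_abelian: "asymptotically_abelian_in_average \<alpha> \<omega>"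
  unfolding asymptotically_abelian_in_average_def
proof (intro allI impI)
  fix \<Lambda> a b c d assume \<Lambda>: "folner_sequence \<Lambda>"
  let ?T = "\<lambda>a b c d g. \<omega> (c * (\<alpha> g a * b - b * \<alpha> g a) * d)"
  note lin = clinear_on_def \<alpha>_simps distrib_left distrib_right right_diff_distrib left_diff_distrib
    mult_scaleC_left mult_scaleC_right add diff scale scaleC_complex_def
  have d: "d \<in> {d. has_mean \<Lambda> (?T a b c d) 0}"
    if m: "fermi_monomial \<beta> \<iota> UNIV p a" "fermi_monomial \<beta> \<iota> UNIV q b" "fermi_monomial \<beta> \<iota> UNIV r c"
    for p a q b r c d
  proof (rule monomials_dense)
    have "clinear_on UNIV (\<lambda>d. ?T a b c d g)" for g by (simp add: lin)
    moreover have "cmod (?T a b c d g) \<le> (2 * (norm a * norm b * norm c)) * norm d" for d g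
      using commutator_bound[of c g a b d] by (simp add: mult_ac)
    ultimately show "closed {d. has_mean \<Lambda> (?T a b c d) 0}"
        "complex_vector.subspace {d. has_mean \<Lambda> (?T a b c d) 0}"
      by (rule has_mean_zero_closed_subspace)+
  qed (use monomial_commutator_mean[OF \<Lambda> m] in blast)
  have c: "c \<in> {c. has_mean \<Lambda> (?T a b c d) 0}"
    if m: "fermi_monomial \<beta> \<iota> UNIV p a" "fermi_monomial \<beta> \<iota> UNIV q b" for p a q b c d
  proof (rule monomials_dense)
    have "clinear_on UNIV (\<lambda>c. ?T a b c d g)" for g by (simp add: lin)
    moreover have "cmod (?T a b c d g) \<le> (2 * (norm a * norm b * norm d)) * norm c" for c g
      using commutator_bound[of c g a b d] by (simp add: mult_ac)
    ultimately show "closed {c. has_mean \<Lambda> (?T a b c d) 0}"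
        "complex_vector.subspace {c. has_mean \<Lambda> (?T a b c d) 0}"
      by (rule has_mean_zero_closed_subspace)+
  qed (use d[OF m] in blast)
  have b: "b \<in> {b. has_mean \<Lambda> (?T a b c d) 0}"
    if m: "fermi_monomial \<beta> \<iota> UNIV p a" for p a b c d
  proof (rule monomials_dense)
    have "clinear_on UNIV (\<lambda>b. ?T a b c d g)" for g by (simp add: lin)
    moreover have "cmod (?T a b c d g) \<le> (2 * (norm a * norm c * norm d)) * norm b" for b g
      using commutator_bound[of c g a b d] by (simp add: mult_ac)
    ultimately show "closed {b. has_mean \<Lambda> (?T a b c d) 0}"
        "complex_vector.subspace {b. has_mean \<Lambda> (?T a b c d) 0}"
      by (rule has_mean_zero_closed_subspace)+
  qed (use c[OF m] in blast)
  have "a \<in> {a. has_mean \<Lambda> (?T a b c d) 0}"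
  proof (rule monomials_dense)
    have "clinear_on UNIV (\<lambda>a. ?T a b c d g)" for g by (simp add: lin)
    moreover have "cmod (?T a b c d g) \<le> (2 * (norm b * norm c * norm d)) * norm a" for a g
      using commutator_bound[of c g a b d] by (simp add: mult_ac)
    ultimately show "closed {a. has_mean \<Lambda> (?T a b c d) 0}"
        "complex_vector.subspace {a. has_mean \<Lambda> (?T a b c d) 0}"
      by (rule has_mean_zero_closed_subspace)+
  qed (use b in blast)
  then show "has_mean \<Lambda> (?T a b c d) 0" by simp
qed

end

section \<open>Hilbert spaces and finite symmetric groups\<close>

lemma cinner_add_left: "cinner (x + y) z = cinner x z + cinner y (z::'h::complex_hilbert)"
  by (subst (1 2 3) cinner_commute) (simp add: cinner_add_right)

lemma cinner_scaleC_left: "cinner (w *\<^sub>C x) y = cnj w * cinner x (y::'h::complex_hilbert)"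
  by (subst (1 2) cinner_commute) (simp add: cinner_scaleC_right)

lemma cinner_cauchy_schwarz: "cmod (cinner x y) \<le> norm x * norm (y::'h::complex_hilbert)"
proof -
  have "(cmod (cinner x y))\<^sup>2 \<le> Re (cinner x x) * Re (cinner y y)"
    by (rule cauchy_schwarz_sesquilinear)
      (auto simp: cinner_add_left cinner_add_right cinner_scaleC_left cinner_scaleC_right cinner_norm
        simp flip: of_real_power)
  also have "\<dots> = (norm x * norm y)\<^sup>2"
    by (simp add: cinner_norm power_mult_distrib flip: of_real_power)
  finally show ?thesis by (rule power2_le_imp_le) simp
qed

lemma cinner_diff_right: "cinner x (y - z) = cinner x y - cinner x (z::'h::complex_hilbert)"
  using cinner_add_right[of x "y - z" z] by simp

lemma cinner_diff_left: "cinner (x - y) z = cinner x z - cinner y (z::'h::complex_hilbert)"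
  using cinner_add_left[of "x - y" y z] by simp

lemma cinner_sum_right: "cinner x (sum f A) = (\<Sum>i\<in>A. cinner x (f i :: 'h::complex_hilbert))"
proof -
  have "cinner x 0 = 0" using cinner_diff_right[of x 0 0] by simp
  then show ?thesis by (induction A rule: infinite_finite_induct) (auto simp: cinner_add_right)
qed

lemma tendsto_cinner_right:
  assumes "X \<longlonglongrightarrow> (x::'h::complex_hilbert)"
  shows "(\<lambda>n. cinner z (X n)) \<longlonglongrightarrow> cinner z x"
proof -
  have "bounded_linear (cinner z)"
    by (rule bounded_linear_intro[where K="norm z"])
      (auto simp: cinner_add_right scaleR_scaleC cinner_scaleC_right scaleC_complex_def
        intro: order_trans[OF cinner_cauchy_schwarz] simp: mult.commute)
  then show ?thesis using assms by (rule bounded_linear.tendsto)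
qed

lemma clinear_on_diff:
  assumes "clinear_on V f" "complex_vector.subspace V" "x \<in> V" "y \<in> V"
  shows "f (x - y) = f x - f y"
proof -
  have "f ((x - y) + y) = f (x - y) + f y"
    using assms complex_vector.subspace_diff[OF assms(2-4)] unfolding clinear_on_def by blast
  then show ?thesis by simp
qed

lemma clinear_on_sum:
  assumes "clinear_on V f" "complex_vector.subspace V" "\<And>i. i \<in> A \<Longrightarrow> x i \<in> V"
  shows "f (sum x A) = (\<Sum>i\<in>A. f (x i))"
proof -
  have "f (0 - 0) = f 0 - f 0"
    using assms(1,2) complex_vector.subspace_0 clinear_on_diff by metis
  then have "f 0 = 0" by simp
  then show ?thesis
    using assms(3)
  proof (induction A rule: infinite_finite_induct)
    case (insert a A)
    have "sum x A \<in> V" using insert.prems by (intro complex_vector.subspace_sum assms(2)) auto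
    then show ?case using insert assms(1) by (simp add: clinear_on_def)
  qed auto
qed

lemma tendsto_bounded_clinear_on:
  fixes f :: "'h::complex_hilbert \<Rightarrow> 'h"
  assumes f: "clinear_on V f" "complex_vector.subspace V" "\<And>x. x \<in> V \<Longrightarrow> norm (f x) \<le> K * norm x"
    and X: "\<And>n. X n \<in> V" "x \<in> V" "X \<longlonglongrightarrow> x"
  shows "(\<lambda>n. f (X n)) \<longlonglongrightarrow> f x"
proof -
  have le: "norm (f (X n) - f x) \<le> K * norm (X n - x)" for n
    using f(3)[of "X n - x"] complex_vector.subspace_diff[OF f(2) X(1,2)] clinear_on_diff[OF f(1,2) X(1,2)]
    by simp
  have "(\<lambda>n. K * norm (X n - x)) \<longlonglongrightarrow> 0"
    using tendsto_mult_right_zero[OF tendsto_norm_zero[OF X(3)[THEN LIM_zero]]] .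
  then have "(\<lambda>n. f (X n) - f x) \<longlonglongrightarrow> 0"
    by (rule Lim_null_comparison[OF always_eventually[OF allI[OF le]]])
  then show ?thesis by (rule LIM_zero_cancel)
qed

text \<open>The symmetric group on the letters below \<open>n\<close>. These subgroups exhaust the group of finite permutations and
form a Folner sequence for a trivial reason: a given permutation belongs to almost all of them.\<close>

definition Sym :: "nat \<Rightarrow> nat perm set" where
  "Sym n = {g. affected g \<subseteq> {..<n}}"

lemma finite_Sym [simp]: "finite (Sym n)"
proof (rule finite_subset)
  show "Sym n \<subseteq> Perm ` {p. p permutes {..<n}}"
  proof
    fix g assume "g \<in> Sym n"
    then have "Perm.apply g permutes {..<n}"
      by (auto simp: Sym_def permutes_def in_affected bij_iff[THEN iffD1, OF bij_apply])
    then show "g \<in> Perm ` {p. p permutes {..<n}}" by (metis apply_inverse mem_Collect_eq image_eqI perm.apply_inverse)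
  qed
qed (simp add: finite_permutations)

lemma one_in_Sym [simp]: "1 \<in> Sym n" by (simp add: Sym_def)

lemma Sym_times: "\<lbrakk>g \<in> Sym n; h \<in> Sym n\<rbrakk> \<Longrightarrow> g * h \<in> Sym n"
  unfolding Sym_def using affected_times[of g h] by blast

lemma Sym_inverse [simp]: "inverse g \<in> Sym n \<longleftrightarrow> g \<in> Sym n"
  by (simp add: Sym_def)

lemma Sym_mono: "m \<le> n \<Longrightarrow> Sym m \<subseteq> Sym n"
  by (auto simp: Sym_def)

lemma in_some_Sym: "\<exists>n. g \<in> Sym n"
  using finite_nat_bounded[OF finite_affected[of g]] by (auto simp: Sym_def)

lemma bij_betw_Sym_times: "g \<in> Sym n \<Longrightarrow> bij_betw (\<lambda>h. g * h) (Sym n) (Sym n)"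
  by (rule bij_betw_byWitness[where f'="\<lambda>h. inverse g * h"])
    (auto simp: Sym_times simp flip: mult.assoc)

lemma bij_betw_Sym_inverse: "bij_betw inverse (Sym n) (Sym n)"
  by (rule bij_betw_byWitness[where f'=inverse])
    auto

lemma folner_sequence_Sym: "folner_sequence Sym"
  unfolding folner_sequence_def
proof (intro conjI allI)
  show "Sym n \<noteq> {}" for n using one_in_Sym by blast
  fix h
  obtain N where N: "h \<in> Sym N" using in_some_Sym by blast
  have "\<forall>\<^sub>F n in sequentially. 0 = real (card (sym_diff ((\<lambda>g. h * g) ` Sym n) (Sym n))) / real (card (Sym n))"
    using eventually_ge_at_top[of N]
  proof eventually_elim
    case (elim n)
    then have "h \<in> Sym n" using N Sym_mono by blast
    then show ?case using bij_betw_Sym_times[of h n] by (simp add: bij_betw_def)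
  qed
  then show "(\<lambda>n. real (card (sym_diff ((\<lambda>g. h * g) ` Sym n) (Sym n))) / real (card (Sym n))) \<longlonglongrightarrow> 0"
    by (rule Lim_transform_eventually[OF tendsto_const])
qed simp

section \<open>The mean ergodic theorem for finite permutations\<close>

lemma unitary_on_linear: "unitary_on H u \<Longrightarrow> clinear_on H u"
  by (simp add: unitary_on_def)

lemma unitary_on_in: "\<lbrakk>unitary_on H u; x \<in> H\<rbrakk> \<Longrightarrow> u x \<in> H"
  by (auto simp: unitary_on_def)

lemma unitary_on_norm:
  assumes "unitary_on H u" "x \<in> H"
  shows "norm (u x) = norm x"
proof -
  have "complex_of_real ((norm (u x))\<^sup>2) = complex_of_real ((norm x)\<^sup>2)"
    using assms by (simp add: unitary_on_def flip: cinner_norm del: of_real_power)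
  then have "(norm (u x))\<^sup>2 = (norm x)\<^sup>2" by (simp only: of_real_eq_iff)
  then show ?thesis by simp
qed

text \<open>The averages over the groups \<^term>\<open>Sym n\<close> are the orthogonal projections onto the vectors that are invariant
under \<^term>\<open>Sym n\<close>. They decrease with \<open>n\<close> and therefore converge strongly to the projection onto the vectors
that are invariant under all permutations, whose existence is obtained at the same time.\<close>

locale unitary_perm_action =
  fixes H :: "'h::complex_hilbert set" and U :: "nat perm \<Rightarrow> 'h \<Rightarrow> 'h"
  assumes subspace: "complex_vector.subspace H" and closed: "closed H"
    and unitary: "\<And>g. unitary_on H (U g)"
    and U_times: "\<And>g h x. x \<in> H \<Longrightarrow> U (g * h) x = U g (U h x)"
begin

lemmas U_linear = unitary_on_linear[OF unitary]
  and U_in [simp] = unitary_on_in[OF unitary]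
  and U_norm = unitary_on_norm[OF unitary]

lemma U_cinner: "\<lbrakk>x \<in> H; y \<in> H\<rbrakk> \<Longrightarrow> cinner (U g x) (U g y) = cinner x y"
  using unitary[of g] by (simp add: unitary_on_def)

lemma U_1: "x \<in> H \<Longrightarrow> U 1 x = x"
proof -
  assume x: "x \<in> H"
  have "norm (U 1 x - x) = norm (U 1 (U 1 x - x))"
    using x by (simp add: U_norm complex_vector.subspace_diff[OF subspace])
  also have "U 1 (U 1 x - x) = 0"
    using x U_times[OF x, of 1 1] by (simp add: clinear_on_diff[OF U_linear subspace])
  finally show ?thesis by simp
qed

lemma U_inverse: "x \<in> H \<Longrightarrow> U g (U (inverse g) x) = x"
  using U_times[of x g "inverse g"] by (simp add: U_1)

lemma U_adjoint: "\<lbrakk>x \<in> H; y \<in> H\<rbrakk> \<Longrightarrow> cinner (U g x) y = cinner x (U (inverse g) y)"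
  using U_cinner[of x "U (inverse g) y" g] by (simp add: U_inverse)

definition avg :: "nat \<Rightarrow> 'h \<Rightarrow> 'h" where
  "avg n x = (1 / of_nat (card (Sym n))) *\<^sub>C (\<Sum>g\<in>Sym n. U g x)"

lemma card_Sym_pos: "0 < card (Sym n)"
proof -
  have "Sym n \<noteq> {}" using one_in_Sym[of n] by blast
  then show ?thesis by (simp add: card_gt_0_iff)
qed

lemma avg_in: "x \<in> H \<Longrightarrow> avg n x \<in> H"
  unfolding avg_def
  by (rule complex_vector.subspace_scale[OF subspace complex_vector.subspace_sum[OF subspace U_in]])

lemma clinear_on_avg:
  assumes f: "clinear_on H f" and x: "x \<in> H"
  shows "f (avg n x) = (1 / of_nat (card (Sym n))) *\<^sub>C (\<Sum>g\<in>Sym n. f (U g x))"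
proof -
  have "(\<Sum>g\<in>Sym n. U g x) \<in> H"
    by (rule complex_vector.subspace_sum[OF subspace U_in[OF x]])
  then have "f (avg n x) = (1 / of_nat (card (Sym n))) *\<^sub>C f (\<Sum>g\<in>Sym n. U g x)"
    using f unfolding avg_def clinear_on_def by blast
  also have "f (\<Sum>g\<in>Sym n. U g x) = (\<Sum>g\<in>Sym n. f (U g x))"
    by (rule clinear_on_sum[OF f subspace U_in[OF x]])
  finally show ?thesis .
qed

lemma U_avg: "\<lbrakk>x \<in> H; g \<in> Sym n\<rbrakk> \<Longrightarrow> U g (avg n x) = avg n x"
  unfolding clinear_on_avg[OF U_linear]
  using sum.reindex_bij_betw[OF bij_betw_Sym_times, of g n "\<lambda>h. U h x"]
  by (simp add: U_times avg_def)

lemma avg_invariant: "(\<And>g. g \<in> Sym n \<Longrightarrow> U g x = x) \<Longrightarrow> avg n x = x"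
proof -
  assume "\<And>g. g \<in> Sym n \<Longrightarrow> U g x = x"
  then have "(\<Sum>g\<in>Sym n. U g x) = real (card (Sym n)) *\<^sub>R x"
    by (simp add: sum_constant_scaleR)
  moreover have "card (Sym n) \<noteq> 0" using card_Sym_pos[of n] by linarith
  ultimately show ?thesis by (simp add: avg_def scaleR_scaleC scaleC_scaleC del: card_eq_0_iff card_0_eq)
qed

lemma cinner_avg: "cinner z (avg n x) = (\<Sum>g\<in>Sym n. cinner z (U g x)) / of_nat (card (Sym n))"
  by (simp add: avg_def cinner_scaleC_right cinner_sum_right)

lemma avg_selfadjoint:
  assumes "x \<in> H" "y \<in> H"
  shows "cinner (avg n x) y = cinner x (avg n y)"
proof -
  have "cinner (avg n x) y = cnj (\<Sum>g\<in>Sym n. cinner y (U g x)) / of_nat (card (Sym n))"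
    by (subst cinner_commute) (simp add: cinner_avg)
  also have "cnj (\<Sum>g\<in>Sym n. cinner y (U g x)) = (\<Sum>g\<in>Sym n. cinner (U g x) y)"
    by (simp flip: cinner_commute)
  also have "\<dots> = (\<Sum>g\<in>Sym n. cinner x (U (inverse g) y))"
    using assms by (simp add: U_adjoint)
  also have "\<dots> = (\<Sum>g\<in>Sym n. cinner x (U g y))"
    by (rule sum.reindex_bij_betw[OF bij_betw_Sym_inverse])
  finally show ?thesis by (simp add: cinner_avg)
qed

text \<open>The vector \<open>avg n x\<close> is the projection of \<open>avg m x\<close> onto a smaller subspace, if \<open>m \<le> n\<close>.\<close>

lemma avg_pythagoras:
  assumes x: "x \<in> H" and mn: "m \<le> n"
  shows "(norm (avg m x - avg n x))\<^sup>2 = (norm (avg m x))\<^sup>2 - (norm (avg n x))\<^sup>2"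
proof -
  have mixed: "cinner (avg k x) (avg n x) = cinner x (avg n x)" if "k \<le> n" for k
  proof -
    have "avg k (avg n x) = avg n x"
      using Sym_mono[OF that] U_avg[OF x] by (intro avg_invariant) blast
    then show ?thesis using x by (simp add: avg_selfadjoint avg_in)
  qed
  have 1: "cinner (avg m x) (avg n x) = of_real ((norm (avg n x))\<^sup>2)"
    using mixed[OF mn] mixed[of n] cinner_norm[of "avg n x"] by simp
  then have 2: "cinner (avg n x) (avg m x) = of_real ((norm (avg n x))\<^sup>2)"
    by (subst cinner_commute) simp
  have "complex_of_real ((norm (avg m x - avg n x))\<^sup>2) = cinner (avg m x - avg n x) (avg m x - avg n x)"
    by (simp only: cinner_norm)
  also have "\<dots> = cinner (avg m x) (avg m x) - cinner (avg n x) (avg m x)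
      - (cinner (avg m x) (avg n x) - cinner (avg n x) (avg n x))"
    by (simp only: cinner_diff_right cinner_diff_left)
  also have "\<dots> = complex_of_real ((norm (avg m x))\<^sup>2 - (norm (avg n x))\<^sup>2)"
    unfolding 1 2 cinner_norm by (simp del: of_real_power)
  finally show ?thesis by (simp only: of_real_eq_iff)
qed

definition invariants :: "'h set" where
  "invariants = {x \<in> H. \<forall>g. U g x = x}"

text \<open>The squared norms of the averages decrease and hence form a Cauchy sequence; by \<open>avg_pythagoras\<close> their
differences are the squared distances of the averages.\<close>

lemma avg_convergent:
  assumes x: "x \<in> H"
  shows "\<exists>p. (\<lambda>n. avg n x) \<longlonglongrightarrow> p \<and> p \<in> invariants \<and> (\<forall>z\<in>invariants. cinner z (x - p) = 0)"
proof -
  define r where "r n = (norm (avg n x))\<^sup>2" for n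
  have "decseq r"
  proof (rule decseq_SucI)
    fix n
    have "0 \<le> (norm (avg n x - avg (Suc n) x))\<^sup>2" by simp
    also have "\<dots> = r n - r (Suc n)" unfolding r_def by (rule avg_pythagoras[OF x]) simp
    finally have "0 \<le> r n - r (Suc n)" .
    then show "r (Suc n) \<le> r n" by linarith
  qed
  then obtain L where "r \<longlonglongrightarrow> L"
    using decseq_convergent[of r 0] by (auto simp: r_def)
  then have "Cauchy r" by (rule LIMSEQ_imp_Cauchy)
  have sq: "(dist (avg m x) (avg n x))\<^sup>2 = dist (r m) (r n)" for m n
  proof -
    have *: "(dist (avg m x) (avg n x))\<^sup>2 = dist (r m) (r n)" if "m \<le> n" for m n
      using avg_pythagoras[OF x that] decseqD[OF \<open>decseq r\<close> that] by (simp add: r_def dist_norm)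
    show ?thesis using *[of m n] *[of n m] by (cases "m \<le> n") (auto simp: dist_commute)
  qed
  have "Cauchy (\<lambda>n. avg n x)"
  proof (rule metric_CauchyI)
    fix e :: real assume e: "0 < e"
    then obtain N where N: "\<And>m n. m \<ge> N \<Longrightarrow> n \<ge> N \<Longrightarrow> dist (r m) (r n) < e\<^sup>2"
      using metric_CauchyD[OF \<open>Cauchy r\<close>, of "e\<^sup>2"] by auto
    have "dist (avg m x) (avg n x) < e" if "m \<ge> N" "n \<ge> N" for m n
      using N[OF that] e unfolding sq[symmetric] by (simp add: power2_less_imp_less)
    then show "\<exists>N. \<forall>m\<ge>N. \<forall>n\<ge>N. dist (avg m x) (avg n x) < e" by blast
  qed
  then obtain p where p: "(\<lambda>n. avg n x) \<longlonglongrightarrow> p"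
    using Cauchy_convergent by (auto simp: convergent_def)
  have pH: "p \<in> H"
    using closed_sequentially[OF closed _ p] avg_in[OF x] by blast
  have "U g p = p" for g
  proof -
    have "(\<lambda>n. U g (avg n x)) \<longlonglongrightarrow> U g p"
      by (rule tendsto_bounded_clinear_on[OF U_linear subspace, where K=1])
        (use p pH x in \<open>auto simp: U_norm avg_in\<close>)
    moreover obtain N where "g \<in> Sym N" using in_some_Sym by blast
    then have "U g (avg n x) = avg n x" if "n \<ge> N" for n
      using Sym_mono[OF that] U_avg[OF x] by blast
    then have "\<forall>\<^sub>F n in sequentially. U g (avg n x) = avg n x"
      using eventually_ge_at_top[of N] by (rule eventually_mono[rotated])
    ultimately have "(\<lambda>n. avg n x) \<longlonglongrightarrow> U g p"
      by (rule Lim_transform_eventually)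
    then show ?thesis using p LIMSEQ_unique by blast
  qed
  moreover have "cinner z (x - p) = 0" if z: "z \<in> invariants" for z
  proof -
    have "cinner z (avg n x) = cinner z x" for n
      using z x avg_selfadjoint[of z x n] avg_invariant[of n z] by (simp add: invariants_def)
    then have "(\<lambda>n. cinner z x) \<longlonglongrightarrow> cinner z p"
      using tendsto_cinner_right[OF p, of z] by simp
    then show ?thesis by (simp add: cinner_diff_right LIMSEQ_const_iff)
  qed
  ultimately show ?thesis using p pH by (auto simp: invariants_def)
qed

lemma projection_eqI:
  assumes "p \<in> invariants" "\<forall>z\<in>invariants. cinner z (x - p) = 0"
  shows "invariant_projection H U x = p"
  unfolding invariant_projection_def orthogonal_projection_def invariants_def[symmetric]
proof (rule the_equality)
  fix q assume q: "q \<in> invariants \<and> (\<forall>z\<in>invariants. cinner z (x - q) = 0)"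
  have pq: "p \<in> H" "q \<in> H" "U g p = p" "U g q = q" for g
    using assms(1) q by (simp_all add: invariants_def)
  have "p - q \<in> H" by (rule complex_vector.subspace_diff[OF subspace pq(1,2)])
  moreover have "U g (p - q) = p - q" for g
    using clinear_on_diff[OF U_linear[of g] subspace pq(1,2)] by (simp add: pq)
  ultimately have "p - q \<in> invariants" by (simp add: invariants_def)
  then have "cinner (p - q) (x - q) - cinner (p - q) (x - p) = 0" using assms(2) q by simp
  then have "cinner (p - q) (p - q) = 0" by (simp add: cinner_diff_right)
  then show "q = p" by (simp add: cinner_norm)
qed (use assms in auto)

lemma mean_ergodic:
  assumes "x \<in> H"
  shows "(\<lambda>n. avg n x) \<longlonglongrightarrow> invariant_projection H U x"
    and "invariant_projection H U x \<in> invariants"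
proof -
  obtain p where p: "(\<lambda>n. avg n x) \<longlonglongrightarrow> p" "p \<in> invariants" "\<forall>z\<in>invariants. cinner z (x - p) = 0"
    using avg_convergent[OF assms] by blast
  have "invariant_projection H U x = p" by (rule projection_eqI[OF p(2,3)])
  then show "(\<lambda>n. avg n x) \<longlonglongrightarrow> invariant_projection H U x"
    and "invariant_projection H U x \<in> invariants"
    using p by simp_all
qed

lemma projection_invariant: "x \<in> invariants \<Longrightarrow> invariant_projection H U x = x"
  using cinner_diff_right[of _ x x] by (intro projection_eqI ballI) simp_all

text \<open>The definite description behind \<^const>\<open>invariant_projection\<close> depends on a vector only through its inner
products with invariant vectors.\<close>

lemma projection_cong:
  assumes "\<And>z. z \<in> invariants \<Longrightarrow> cinner z x = cinner z y"
  shows "invariant_projection H U x = invariant_projection H U y"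
proof -
  have "(\<forall>z\<in>invariants. cinner z (x - p) = 0) \<longleftrightarrow> (\<forall>z\<in>invariants. cinner z (y - p) = 0)" for p
    using assms by (simp add: cinner_diff_right)
  then show ?thesis
    unfolding invariant_projection_def orthogonal_projection_def invariants_def[symmetric] by simp
qed

end

section \<open>The GNS representation of a symmetric state\<close>

locale symmetric_gns = symmetric_fermi_state \<beta> \<iota> \<theta> \<alpha> \<omega>
  for \<beta> :: "'b::cstar_algebra \<Rightarrow> 'b" and \<iota> :: "nat \<Rightarrow> 'b \<Rightarrow> 'a::cstar_algebra" and \<theta> \<alpha> \<omega> +
  fixes H :: "'h::complex_hilbert set" and \<pi> :: "'a \<Rightarrow> 'h \<Rightarrow> 'h" and U :: "nat perm \<Rightarrow> 'h \<Rightarrow> 'h" and \<xi> :: 'h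
  assumes covariant: "covariant_gns_representation \<alpha> \<omega> H \<pi> U \<xi>"
begin

lemma gns: "gns_representation \<omega> H \<pi> \<xi>"
  using covariant by (simp add: covariant_gns_representation_def)

lemma H_subspace: "complex_vector.subspace H" and H_closed: "closed H" and \<xi>_in: "\<xi> \<in> H"
  and \<pi>_in: "x \<in> H \<Longrightarrow> \<pi> a x \<in> H" and \<pi>_linear: "clinear_on H (\<pi> a)"
  and \<pi>_linear_alg: "x \<in> H \<Longrightarrow> clinear_on UNIV (\<lambda>a. \<pi> a x)"
  and \<pi>_mult: "x \<in> H \<Longrightarrow> \<pi> (a * b) x = \<pi> a (\<pi> b x)"
  and \<pi>_star: "\<lbrakk>x \<in> H; y \<in> H\<rbrakk> \<Longrightarrow> cinner (\<pi> (star a) x) y = cinner x (\<pi> a y)"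
  and cyclic: "closure (range (\<lambda>a. \<pi> a \<xi>)) = H"
  and \<omega>_vector: "\<omega> a = cinner \<xi> (\<pi> a \<xi>)"
  using gns by (simp_all add: gns_representation_def image_subset_iff)

lemma \<pi>_bounded: "\<exists>K\<ge>0. \<forall>x\<in>H. norm (\<pi> a x) \<le> K * norm x"
proof -
  have "\<forall>a. \<pi> a ` H \<subseteq> H \<and> clinear_on H (\<pi> a) \<and> (\<exists>K. \<forall>x\<in>H. norm (\<pi> a x) \<le> K * norm x)"
    using gns unfolding gns_representation_def by (elim conjE)
  then obtain K where K: "\<forall>x\<in>H. norm (\<pi> a x) \<le> K * norm x" by meson
  have "norm (\<pi> a x) \<le> max K 0 * norm x" if "x \<in> H" for x
    using bspec[OF K that] mult_right_mono[of K "max K 0" "norm x"] by simp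
  then show ?thesis by (intro exI[of _ "max K 0"] conjI ballI) simp_all
qed

lemma U_unitary: "unitary_on H (U g)" and U_\<pi>: "U g (\<pi> a \<xi>) = \<pi> (\<alpha> g a) \<xi>"
  using covariant by (auto simp: covariant_gns_representation_def)

lemma cyclic_sequence:
  assumes "x \<in> H"
  shows "\<exists>c. (\<lambda>n. \<pi> (c n) \<xi>) \<longlonglongrightarrow> x"
proof -
  obtain X where X: "\<And>n. X n \<in> range (\<lambda>a. \<pi> a \<xi>)" "X \<longlonglongrightarrow> x"
    using assms unfolding cyclic[symmetric] closure_sequential by blast
  then have "\<exists>c. X n = \<pi> c \<xi>" for n by blast
  then obtain c where "\<And>n. X n = \<pi> (c n) \<xi>" by metis
  then have "X = (\<lambda>n. \<pi> (c n) \<xi>)" by auto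
  then show ?thesis using X(2) by blast
qed

text \<open>Identities between bounded operators only have to be checked on the orbit of the cyclic vector.\<close>

lemma eq_on_cyclic:
  fixes f g :: "'h \<Rightarrow> 'h"
  assumes f: "clinear_on H f" "\<And>x. x \<in> H \<Longrightarrow> norm (f x) \<le> K * norm x"
    and g: "clinear_on H g" "\<And>x. x \<in> H \<Longrightarrow> norm (g x) \<le> L * norm x"
    and eq: "\<And>c. f (\<pi> c \<xi>) = g (\<pi> c \<xi>)" and x: "x \<in> H"
  shows "f x = g x"
proof -
  obtain c where c: "(\<lambda>n. \<pi> (c n) \<xi>) \<longlonglongrightarrow> x" using cyclic_sequence[OF x] by blast
  have "(\<lambda>n. f (\<pi> (c n) \<xi>)) \<longlonglongrightarrow> f x"
    by (rule tendsto_bounded_clinear_on[OF f(1) H_subspace _ _ x c])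
      (rule f(2) \<pi>_in[OF \<xi>_in]; assumption)+
  moreover have "(\<lambda>n. g (\<pi> (c n) \<xi>)) \<longlonglongrightarrow> g x"
    by (rule tendsto_bounded_clinear_on[OF g(1) H_subspace _ _ x c])
      (rule g(2) \<pi>_in[OF \<xi>_in]; assumption)+
  ultimately show ?thesis unfolding eq by (rule LIMSEQ_unique)
qed

lemma norm_\<pi>_\<xi>: "norm (\<pi> a \<xi>) \<le> norm a"
proof -
  have "complex_of_real ((norm (\<pi> a \<xi>))\<^sup>2) = cinner (\<pi> (star (star a)) \<xi>) (\<pi> a \<xi>)"
    by (simp only: cinner_norm star_star)
  also have "\<dots> = \<omega> (star a * a)"
    by (simp only: \<pi>_star[OF \<xi>_in \<pi>_in[OF \<xi>_in]] \<pi>_mult[OF \<xi>_in, symmetric] \<omega>_vector)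
  finally have "(norm (\<pi> a \<xi>))\<^sup>2 = Re (\<omega> (star a * a))"
    by (metis Re_complex_of_real)
  also have "\<dots> \<le> (norm a)\<^sup>2" using square_bound[of a] by (simp add: \<omega>_1)
  finally show ?thesis by (rule power2_le_imp_le) simp
qed

lemma clinear_on_compose:
  fixes f g :: "'h \<Rightarrow> 'h"
  assumes "clinear_on H f" "clinear_on H g" "\<And>x. x \<in> H \<Longrightarrow> g x \<in> H"
  shows "clinear_on H (\<lambda>x. f (g x))"
  using assms by (simp add: clinear_on_def)

lemma clinear_on_orbit:
  fixes f :: "'h \<Rightarrow> 'h"
  assumes "clinear_on H f"
  shows "clinear_on UNIV (\<lambda>c. f (\<pi> c \<xi>))"
  using assms \<pi>_linear_alg[OF \<xi>_in] \<pi>_in[OF \<xi>_in] by (simp add: clinear_on_def)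

text \<open>On \<open>\<pi> c \<xi>\<close> with a monomial \<open>c\<close> this is \<open>\<alpha>_times_monomial\<close>. As \<open>c \<mapsto> \<pi> c \<xi>\<close> is contractive and the operators
\<open>U g\<close> are isometric, it extends first to all \<open>c\<close> and then, by cyclicity, to all vectors.\<close>

lemma U_homomorphism:
  assumes "x \<in> H"
  shows "U (g * h) x = U g (U h x)"
proof (rule eq_on_cyclic[where K=1 and L=1, OF _ _ _ _ _ assms])
  show "clinear_on H (U (g * h))" by (rule unitary_on_linear[OF U_unitary])
  show "clinear_on H (\<lambda>x. U g (U h x))" by (rule clinear_on_compose[OF unitary_on_linear[OF U_unitary] unitary_on_linear[OF U_unitary] unitary_on_in[OF U_unitary]])
  fix c
  have bl: "bounded_linear (\<lambda>c. f (\<pi> c \<xi>))"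
    if f: "clinear_on H f" "\<And>x. x \<in> H \<Longrightarrow> norm (f x) = norm x" for f :: "'h \<Rightarrow> 'h"
  proof (rule bounded_linear_intro[where K=1])
    show "norm (f (\<pi> a \<xi>)) \<le> norm a * 1" for a
      using norm_\<pi>_\<xi>[of a] f(2)[OF \<pi>_in[OF \<xi>_in]] by simp
    show "f (\<pi> (a + b) \<xi>) = f (\<pi> a \<xi>) + f (\<pi> b \<xi>)" for a b
      using clinear_on_orbit[OF f(1)] by (simp add: clinear_on_def)
    show "f (\<pi> (r *\<^sub>R a) \<xi>) = r *\<^sub>R f (\<pi> a \<xi>)" for r a
      using clinear_on_orbit[OF f(1)] by (simp add: clinear_on_def scaleR_scaleC)
  qed
  let ?f = "\<lambda>c. U (g * h) (\<pi> c \<xi>)" and ?g = "\<lambda>c. U g (U h (\<pi> c \<xi>))"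
  have lf: "clinear_on UNIV ?f" by (rule clinear_on_orbit[OF unitary_on_linear[OF U_unitary]])
  have lg: "clinear_on UNIV ?g"
    by (rule clinear_on_orbit[OF clinear_on_compose[OF unitary_on_linear[OF U_unitary] unitary_on_linear[OF U_unitary] unitary_on_in[OF U_unitary]]])
  have "c \<in> {c. ?f c = ?g c}"
  proof (rule monomials_dense)
    have "bounded_linear ?g"
      by (rule bl, rule clinear_on_compose[OF unitary_on_linear[OF U_unitary] unitary_on_linear[OF U_unitary] unitary_on_in[OF U_unitary]])
        (auto simp: unitary_on_norm[OF U_unitary] unitary_on_in[OF U_unitary])
    moreover have "bounded_linear ?f" by (rule bl[OF unitary_on_linear[OF U_unitary] unitary_on_norm[OF U_unitary]])
    ultimately show "closed {c. ?f c = ?g c}"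
      by (intro closed_Collect_eq linear_continuous_on)
    have "?f (0 *\<^sub>C 0) = 0 *\<^sub>C ?f 0" "?g (0 *\<^sub>C 0) = 0 *\<^sub>C ?g 0"
      using lf lg unfolding clinear_on_def by blast+
    then show "complex_vector.subspace {c. ?f c = ?g c}"
      using lf lg by (intro complex_vector.subspaceI) (simp_all add: clinear_on_def)
    fix p c assume "fermi_monomial \<beta> \<iota> UNIV p c"
    then show "c \<in> {c. ?f c = ?g c}" by (simp add: U_\<pi> \<alpha>_times_monomial)
  qed
  then show "?f c = ?g c" by simp
qed (simp_all add: unitary_on_norm[OF U_unitary] unitary_on_in[OF U_unitary])

sublocale unitary_perm_action H U
  by unfold_locales (use H_subspace H_closed U_unitary U_homomorphism in auto)

lemma \<pi>_\<alpha>_U: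
  assumes "x \<in> H"
  shows "\<pi> (\<alpha> g a) (U g x) = U g (\<pi> a x)"
proof -
  obtain K where K: "\<forall>x\<in>H. norm (\<pi> (\<alpha> g a) x) \<le> K * norm x" using \<pi>_bounded by blast
  obtain L where L: "\<forall>x\<in>H. norm (\<pi> a x) \<le> L * norm x" using \<pi>_bounded by blast
  show ?thesis
  proof (rule eq_on_cyclic[where K=K and L=L, OF _ _ _ _ _ assms])
    show "norm (\<pi> (\<alpha> g a) (U g x)) \<le> K * norm x" if "x \<in> H" for x
      using K that U_norm[OF that, of g] U_in[OF that, of g] by metis
    show "norm (U g (\<pi> a x)) \<le> L * norm x" if "x \<in> H" for x
      using L that U_norm[OF \<pi>_in[OF that]] by simp
    show "\<pi> (\<alpha> g a) (U g (\<pi> c \<xi>)) = U g (\<pi> a (\<pi> c \<xi>))" for c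
      using \<xi>_in by (simp add: U_\<pi> \<alpha>_simps flip: \<pi>_mult)
    show "clinear_on H (\<lambda>x. \<pi> (\<alpha> g a) (U g x))" by (rule clinear_on_compose[OF \<pi>_linear U_linear U_in])
    show "clinear_on H (\<lambda>x. U g (\<pi> a x))" by (rule clinear_on_compose[OF U_linear \<pi>_linear \<pi>_in])
  qed
qed

lemma \<pi>_\<alpha>_bound:
  assumes K: "\<forall>x\<in>H. norm (\<pi> a x) \<le> K * norm x" and x: "x \<in> H"
  shows "norm (\<pi> (\<alpha> g a) x) \<le> K * norm x"
proof -
  let ?y = "U (inverse g) x"
  have "\<pi> (\<alpha> g a) x = U g (\<pi> a ?y)"
    using \<pi>_\<alpha>_U[OF U_in[OF x, of "inverse g"], of g a] x by (simp add: U_inverse)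
  then have "norm (\<pi> (\<alpha> g a) x) = norm (\<pi> a ?y)" using x by (simp add: U_norm \<pi>_in)
  also have "\<dots> \<le> K * norm ?y" by (rule bspec[OF K U_in[OF x]])
  finally show ?thesis by (simp add: U_norm[OF x])
qed

text \<open>For \<open>x = \<pi> c \<xi>\<close> and \<open>y = \<pi> d \<xi>\<close> this is asymptotic abelianness, applied to \<open>star c\<close> and \<open>d\<close>. Such vectors are
dense, and the operators \<open>\<pi> (\<alpha> g a)\<close> are bounded uniformly in \<open>g\<close> by \<open>\<pi>_\<alpha>_bound\<close>.\<close>

lemma commutator_mean:
  assumes x: "x \<in> H" and y: "y \<in> H" and \<Lambda>: "folner_sequence \<Lambda>"
  shows "has_mean \<Lambda> (\<lambda>g. cinner x (\<pi> (\<alpha> g a) (\<pi> b y) - \<pi> b (\<pi> (\<alpha> g a) y))) 0"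
proof -
  define T where "T g y = \<pi> (\<alpha> g a) (\<pi> b y) - \<pi> b (\<pi> (\<alpha> g a) y)" for g y
  obtain K where K: "K \<ge> 0" "\<forall>x\<in>H. norm (\<pi> a x) \<le> K * norm x" using \<pi>_bounded by blast
  obtain L where L: "L \<ge> 0" "\<forall>x\<in>H. norm (\<pi> b x) \<le> L * norm x" using \<pi>_bounded by blast
  have T_diff: "T g (u - v) = T g u - T g v" if "u \<in> H" "v \<in> H" for g u v
    unfolding T_def using that by (simp add: clinear_on_diff[OF \<pi>_linear H_subspace] \<pi>_in)
  have T_bound: "norm (T g u) \<le> (2 * K * L) * norm u" if u: "u \<in> H" for g u
  proof -
    have "norm (\<pi> (\<alpha> g a) (\<pi> b u)) \<le> K * (L * norm u)"
      using \<pi>_\<alpha>_bound[OF K(2) \<pi>_in[OF u]] L(2) u K(1) by (meson mult_left_mono order_trans)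
    moreover have "norm (\<pi> b (\<pi> (\<alpha> g a) u)) \<le> L * (K * norm u)"
      using L(2) \<pi>_in[OF u] \<pi>_\<alpha>_bound[OF K(2) u] L(1) by (meson mult_left_mono order_trans)
    ultimately have "norm (T g u) \<le> K * (L * norm u) + L * (K * norm u)"
      unfolding T_def by (rule order_trans[OF norm_triangle_ineq4 add_mono])
    then show ?thesis by (simp add: algebra_simps)
  qed
  obtain c where c: "(\<lambda>n. \<pi> (c n) \<xi>) \<longlonglongrightarrow> x" using cyclic_sequence[OF x] by blast
  obtain d where d: "(\<lambda>n. \<pi> (d n) \<xi>) \<longlonglongrightarrow> y" using cyclic_sequence[OF y] by blast
  define C where "C = 2 * K * L"
  \<comment> \<open>The error made by replacing \<open>x\<close> and \<open>y\<close> by members of the approximating sequences.\<close>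
  let ?e = "\<lambda>n. norm x * (C * norm (y - \<pi> (d n) \<xi>)) + norm (x - \<pi> (c n) \<xi>) * (C * norm (\<pi> (d n) \<xi>))"
  have "has_mean \<Lambda> (\<lambda>g. cinner x (T g y)) 0"
  proof (rule has_mean_zero_uniform_limit[where f="\<lambda>n g. cinner (\<pi> (c n) \<xi>) (T g (\<pi> (d n) \<xi>))" and e="?e"])
    fix n
    have "cinner (\<pi> (c n) \<xi>) (T g (\<pi> (d n) \<xi>)) = \<omega> (star (c n) * (\<alpha> g a * b - b * \<alpha> g a) * d n)" for g
    proof -
      have diff_alg: "\<pi> (u - v) \<xi> = \<pi> u \<xi> - \<pi> v \<xi>" for u v
        by (rule clinear_on_diff[OF \<pi>_linear_alg[OF \<xi>_in]]) (auto simp: complex_vector.subspace_UNIV)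
      have T_cyclic: "T g (\<pi> (d n) \<xi>) = \<pi> ((\<alpha> g a * b - b * \<alpha> g a) * d n) \<xi>"
        using \<xi>_in unfolding T_def by (simp add: left_diff_distrib diff_alg mult.assoc \<pi>_mult \<pi>_in)
      have "cinner (\<pi> (c n) \<xi>) (T g (\<pi> (d n) \<xi>)) =
          cinner \<xi> (\<pi> (star (c n)) (\<pi> ((\<alpha> g a * b - b * \<alpha> g a) * d n) \<xi>))"
        unfolding T_cyclic using \<pi>_star[OF \<xi>_in \<pi>_in[OF \<xi>_in], of "star (c n)"] by (simp add: star_star)
      also have "\<dots> = \<omega> (star (c n) * (\<alpha> g a * b - b * \<alpha> g a) * d n)"
        using \<xi>_in by (simp only: \<omega>_vector mult.assoc \<pi>_mult \<pi>_in)
      finally show ?thesis .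
    qed
    then show "has_mean \<Lambda> (\<lambda>g. cinner (\<pi> (c n) \<xi>) (T g (\<pi> (d n) \<xi>))) 0"
      using asymptotically_abelian \<Lambda> by (simp add: asymptotically_abelian_in_average_def)
    fix g
    let ?u = "\<pi> (c n) \<xi>" and ?v = "\<pi> (d n) \<xi>"
    have v: "?v \<in> H" by (rule \<pi>_in[OF \<xi>_in])
    have "cinner x (T g y) - cinner ?u (T g ?v) = cinner x (T g (y - ?v)) + cinner (x - ?u) (T g ?v)"
      by (simp add: T_diff[OF y v] cinner_diff_left cinner_diff_right)
    also have "cmod \<dots> \<le> norm x * norm (T g (y - ?v)) + norm (x - ?u) * norm (T g ?v)"
      by (rule order_trans[OF norm_triangle_ineq add_mono[OF cinner_cauchy_schwarz cinner_cauchy_schwarz]])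
    also have "\<dots> \<le> ?e n"
      using T_bound[OF v] T_bound[OF complex_vector.subspace_diff[OF H_subspace y v]]
      by (intro add_mono mult_left_mono) (auto simp: C_def)
    finally show "cmod (cinner x (T g y) - cinner ?u (T g ?v)) \<le> ?e n" .
  next
    have "?e \<longlonglongrightarrow> norm x * (C * norm (y - y)) + norm (x - x) * (C * norm y)"
      by (intro tendsto_intros c d)
    then show "?e \<longlonglongrightarrow> 0" by simp
  qed
  then show ?thesis by (simp add: T_def)
qed

text \<open>By covariance, \<open>\<pi> (\<alpha> g a)\<close> is the conjugate of \<open>\<pi> a\<close> by \<open>U g\<close>. In the coefficients between the invariant
vectors \<open>x\<close> and \<open>y\<close> one of the two outer unitaries disappears, and what remains are the coefficients of
\<open>\<pi> a (U (inverse g)) \<pi> b\<close> and of \<open>\<pi> b (U g) \<pi> a\<close>. Both means over \<^term>\<open>Sym n\<close>, which is closed under inverses,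
are evaluated by the mean ergodic theorem.\<close>

lemma invariant_commute:
  assumes x: "x \<in> invariants" and y: "y \<in> invariants"
  shows "cinner x (\<pi> a (invariant_projection H U (\<pi> b y))) = cinner x (\<pi> b (invariant_projection H U (\<pi> a y)))"
proof -
  have xH: "x \<in> H" "\<And>g. U g x = x" and yH: "y \<in> H" "\<And>g. U g y = y"
    using x y by (auto simp: invariants_def)
  let ?N = "\<lambda>n. of_nat (card (Sym n)) :: complex"
  have avg_\<pi>: "cinner x (\<pi> a (avg n z)) = (\<Sum>g\<in>Sym n. cinner x (\<pi> a (U g z))) / ?N n"
    if z: "z \<in> H" for a n z
    unfolding clinear_on_avg[OF \<pi>_linear z] by (simp add: cinner_scaleC_right cinner_sum_right)
  have left: "cinner x (\<pi> (\<alpha> g a) (\<pi> b y)) = cinner x (\<pi> a (U (inverse g) (\<pi> b y)))" for g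
  proof -
    let ?z = "U (inverse g) (\<pi> b y)"
    have z: "?z \<in> H" by (rule U_in[OF \<pi>_in[OF yH(1)]])
    have "cinner x (\<pi> (\<alpha> g a) (\<pi> b y)) = cinner (U g x) (U g (\<pi> a ?z))"
      using \<pi>_\<alpha>_U[OF z, of g a] yH(1) by (simp add: xH U_inverse \<pi>_in)
    also have "\<dots> = cinner x (\<pi> a ?z)" by (rule U_cinner[OF xH(1) \<pi>_in[OF z]])
    finally show ?thesis .
  qed
  have right: "\<pi> (\<alpha> g a) y = U g (\<pi> a y)" for g
    using \<pi>_\<alpha>_U[OF yH(1), of g a] by (simp add: yH)
  have "(\<Sum>g\<in>Sym n. cinner x (\<pi> (\<alpha> g a) (\<pi> b y) - \<pi> b (\<pi> (\<alpha> g a) y))) / ?N n =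
      cinner x (\<pi> a (avg n (\<pi> b y))) - cinner x (\<pi> b (avg n (\<pi> a y)))" for n
  proof -
    have "(\<Sum>g\<in>Sym n. cinner x (\<pi> a (U (inverse g) (\<pi> b y)))) = (\<Sum>g\<in>Sym n. cinner x (\<pi> a (U g (\<pi> b y))))"
      by (rule sum.reindex_bij_betw[OF bij_betw_Sym_inverse])
    then show ?thesis
      using yH(1) by (simp add: cinner_diff_right sum_subtractf left right avg_\<pi> \<pi>_in diff_divide_distrib)
  qed
  then have lim0: "(\<lambda>n. cinner x (\<pi> a (avg n (\<pi> b y))) - cinner x (\<pi> b (avg n (\<pi> a y)))) \<longlonglongrightarrow> 0"
    using commutator_mean[OF xH(1) yH(1) folner_sequence_Sym, of a b] by (simp add: has_mean_def)
  have lim: "(\<lambda>n. cinner x (\<pi> a (avg n (\<pi> b y)))) \<longlonglongrightarrow> cinner x (\<pi> a (invariant_projection H U (\<pi> b y)))" for a b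
  proof -
    obtain K where K: "\<forall>x\<in>H. norm (\<pi> a x) \<le> K * norm x" using \<pi>_bounded by blast
    have by_H: "\<pi> b y \<in> H" by (rule \<pi>_in[OF yH(1)])
    have PH: "invariant_projection H U (\<pi> b y) \<in> H"
      using mean_ergodic(2)[OF by_H] by (simp add: invariants_def)
    show ?thesis
      by (rule tendsto_cinner_right, rule tendsto_bounded_clinear_on[OF \<pi>_linear H_subspace _ _ PH])
        (use K avg_in[OF by_H] mean_ergodic(1)[OF by_H] in auto)
  qed
  have "cinner x (\<pi> a (invariant_projection H U (\<pi> b y))) - cinner x (\<pi> b (invariant_projection H U (\<pi> a y))) = 0"
    by (rule LIMSEQ_unique[OF tendsto_diff[OF lim lim] lim0])
  then show ?thesis by simp
qed

lemma P_abelian: "P_abelian H \<pi> U"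
proof -
  let ?E = "invariant_projection H U"
  have "?E (\<pi> a (?E (?E (\<pi> b (?E x))))) = ?E (\<pi> b (?E (?E (\<pi> a (?E x)))))" if x: "x \<in> H" for a b x
  proof -
    have y: "?E x \<in> invariants" by (rule mean_ergodic(2)[OF x])
    then have yH: "?E x \<in> H" by (simp add: invariants_def)
    have idem: "?E (?E (\<pi> c (?E x))) = ?E (\<pi> c (?E x))" for c
      by (rule projection_invariant[OF mean_ergodic(2)[OF \<pi>_in[OF yH]]])
    show ?thesis unfolding idem
      by (rule projection_cong[OF invariant_commute[OF _ y]])
  qed
  then show ?thesis by (simp add: P_abelian_def Let_def)
qed

end

theorem theorem5p1:
  fixes \<beta> :: "'b::cstar_algebra \<Rightarrow> 'b"
    and \<iota> :: "nat \<Rightarrow> 'b \<Rightarrow> 'a::cstar_algebra"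
    and \<theta> :: "'a \<Rightarrow> 'a"
    and \<alpha> :: "nat perm \<Rightarrow> 'a \<Rightarrow> 'a"
    and \<omega> :: "'a \<Rightarrow> complex"
  assumes "graded_cstar_algebra UNIV \<beta>"
    and "infinite_fermi_product \<beta> \<iota> \<theta>"
    and "permutation_action \<iota> \<alpha>"
    and "symmetric_state \<alpha> \<omega>"
  shows "\<omega> \<circ> \<theta> = \<omega> \<and>
         (\<forall>(H :: 'h::complex_hilbert set) \<pi> U \<xi>.
            covariant_gns_representation \<alpha> \<omega> H \<pi> U \<xi> \<longrightarrow> P_abelian H \<pi> U) \<and>
         asymptotically_abelian_in_average \<alpha> \<omega>"
proof -
  interpret symmetric_fermi_state \<beta> \<iota> \<theta> \<alpha> \<omega>
    by unfold_locales (fact assms)+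
  have "P_abelian H \<pi> U" if "covariant_gns_representation \<alpha> \<omega> H \<pi> U \<xi>"
    for H :: "'h set" and \<pi> U \<xi>
  proof -
    interpret symmetric_gns \<beta> \<iota> \<theta> \<alpha> \<omega> H \<pi> U \<xi>
      by unfold_locales (fact that)
    show ?thesis by (rule P_abelian)
  qed
  then show ?thesis
    using \<omega>_even asymptotically_abelian by (auto simp: fun_eq_iff)
qed

end
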